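(* Let $d$ be either $0$ or a positive square-free integer, $K=\mathbb{Q}(\sqrt{-d})$, $R$ the ring of integers of $K$. For $n\geq1$ let $G_{1,n}=\mathrm{Aut}(\Gamma_{1,n})$ and $G_{2,n}=\mathrm{Aut}(\Gamma^{un}_{2,n})$. Then: (a) for any such $d$, $G_{1,n}\cong(S_{2n}\times S_{2n})\rtimes C_2$; (b) if $d\neq1,3$, $G_{2,n}\cong S_{2n}\times S_{2n}$; (c) if $d=1$, $G_{2,n}\cong S_{2n}\times S_{2n}\times S_{4n}$; (d) if $d=3$, $G_{2,n}\cong(S_{2n}^2\times S_{2n}^2\times S_{2n}^2)\rtimes S_3$, where $S_{2n}^2=S_{2n}\times S_{2n}$.
   Context: $S_m$ is the symmetric group on $m$ letters and $C_2$ the cyclic group of order $2$; $\mathrm{Aut}$ of an undirected graph is its group of adjacency-preserving vertex bijections. The zero-divisor graph $\Gamma(M_2(R))$ is the directed graph whose vertices are the nonzero (left or right) zero-divisors of $M_2(R)$, with an edge $v_1\to v_2$ between distinct vertices iff $v_1v_2=0$. For an integer $N\geq1$ and $t\in R$, let $S_{tc,1,t,N}=\{\lambda\begin{bmatrix}1&t\\t^2&t^3\end{bmatrix}:\lambda\in\mathbb{Z},\,1\leq|\lambda|\leq N\}$ and $S_{tc,2,N}=\{\begin{bmatrix}0&0\\0&\lambda\end{bmatrix}:\lambda\in\mathbb{Z},\,1\leq|\lambda|\leq N\}$. Let $\Gamma_{1,N}$ be the induced subgraph of $\Gamma(M_2(R))$ on $S_{tc,1,0,N}\cup S_{tc,2,N}$,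 regarded as an undirected graph. Let $U=\{\pm1\}$ if $d\neq1,3$, $U=\{\pm1,\pm i\}$ if $d=1$ ($i=\sqrt{-1}$), $U=\{\pm1,\pm\omega,\pm\omega^2\}$ if $d=3$ ($\omega$ a primitive third root of unity); let $\Gamma_{2,N}$ be the induced subgraph of $\Gamma(M_2(R))$ on $\bigcup_{j\in U}S_{tc,1,j,N}$, and $\Gamma^{un}_{2,N}$ its underlying undirected graph (distinct $v_1,v_2$ adjacent iff $v_1v_2=0$ or $v_2v_1=0$). *)

theory Defs
  imports
    "HOL-Analysis.Analysis"
    "HOL-Algebra.Algebra"
    "HOL-Algebra.Algebraic_Closure_Type"
    "HOL-Computational_Algebra.Computational_Algebra"
    "Graph_Theory.Digraph_Component"
begin

subsection \<open>The ring of integers of an imaginary quadratic field (or of the rationals)\<close>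

text \<open>
  All fields are taken inside the complex numbers. A subfield generated by one element
  contains the rationals, so for \<open>d = 0\<close> this is the field of rational numbers.
\<close>

definition imag_quadratic_field :: "nat \<Rightarrow> complex set" where
  "imag_quadratic_field d =
     generate_field (ring_of_type_algebra :: complex ring) {csqrt (- of_nat d)}"

definition ring_of_integers :: "complex set \<Rightarrow> complex set" where
  "ring_of_integers K = {x \<in> K. algebraic_int x}"

definition mat2_over :: "complex set \<Rightarrow> (complex^2^2) set" where
  "mat2_over R = {A. \<forall>i j. A $ i $ j \<in> R}"

subsection \<open>Zero-divisor graphs\<close>

definition left_zero_divisor :: "(complex^2^2) set \<Rightarrow> complex^2^2 \<Rightarrow> bool" where
  "left_zero_divisor M A \<longleftrightarrow> A \<in> M \<and> (\<exists>B \<in> M. B \<noteq> 0 \<and> A ** B = 0)"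

definition right_zero_divisor :: "(complex^2^2) set \<Rightarrow> complex^2^2 \<Rightarrow> bool" where
  "right_zero_divisor M A \<longleftrightarrow> A \<in> M \<and> (\<exists>B \<in> M. B \<noteq> 0 \<and> B ** A = 0)"

definition zero_divisor_vertices :: "(complex^2^2) set \<Rightarrow> (complex^2^2) set" where
  "zero_divisor_vertices M =
     {A. A \<noteq> 0 \<and> (left_zero_divisor M A \<or> right_zero_divisor M A)}"

definition zero_divisor_graph :: "(complex^2^2) set \<Rightarrow> (complex^2^2) pair_pre_digraph" where
  "zero_divisor_graph M =
     \<lparr>pverts = zero_divisor_vertices M,
      parcs = {(A, B). A \<in> zero_divisor_vertices M \<and> B \<in> zero_divisor_vertices M
                        \<and> A \<noteq> B \<and> A ** B = 0}\<rparr>"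

definition induced_on :: "'a pair_pre_digraph \<Rightarrow> 'a set \<Rightarrow> 'a pair_pre_digraph" where
  "induced_on G S = \<lparr>pverts = pverts G \<inter> S, parcs = parcs G \<inter> S \<times> S\<rparr>"

lemma induced_on_induced_subgraph:
  assumes "pair_wf_digraph G"
  shows "induced_subgraph (with_proj (induced_on G S)) (with_proj G)"
proof -
  interpret pair_wf_digraph G by fact
  have "pair_wf_digraph (induced_on G S)"
    by unfold_locales (auto simp: induced_on_def dest: in_arcsD1 in_arcsD2)
  then interpret H: pair_wf_digraph "induced_on G S" .
  show ?thesis
    by (rule induced_subgraphI)
       (auto simp: subgraph_def induced_on_def compatible_def wf_digraph_axioms
          H.wf_digraph_axioms[unfolded induced_on_def] dest: in_arcsD1 in_arcsD2)
qed

subsection \<open>The subgraphs under consideration\<close>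

definition S_tc1 :: "complex \<Rightarrow> nat \<Rightarrow> (complex^2^2) set" where
  "S_tc1 t N =
     {real_of_int l *\<^sub>R vector [vector [1, t], vector [t^2, t^3]] | l.
        1 \<le> \<bar>l\<bar> \<and> \<bar>l\<bar> \<le> int N}"

definition S_tc2 :: "nat \<Rightarrow> (complex^2^2) set" where
  "S_tc2 N =
     {vector [vector [0, 0], vector [0, of_int l]] | l. 1 \<le> \<bar>l\<bar> \<and> \<bar>l\<bar> \<le> int N}"

definition primitive_cube_root :: complex where
  "primitive_cube_root = cis (2 * pi / 3)"

definition U_set :: "nat \<Rightarrow> complex set" where
  "U_set d =
     (if d = 1 then {1, -1, \<i>, -\<i>}
      else if d = 3 then
        {1, -1, primitive_cube_root, -primitive_cube_root,
         primitive_cube_root^2, -(primitive_cube_root^2)}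
      else {1, -1})"

definition Gamma_M2 :: "nat \<Rightarrow> (complex^2^2) pair_pre_digraph" where
  "Gamma_M2 d = zero_divisor_graph (mat2_over (ring_of_integers (imag_quadratic_field d)))"

text \<open>
  An undirected graph is a symmetric digraph; \<^const>\<open>mk_symmetric\<close> is the underlying
  undirected graph.
\<close>

definition Gamma1 :: "nat \<Rightarrow> nat \<Rightarrow> (complex^2^2) pair_pre_digraph" where
  "Gamma1 d N = mk_symmetric (with_proj (induced_on (Gamma_M2 d) (S_tc1 0 N \<union> S_tc2 N)))"

definition Gamma2 :: "nat \<Rightarrow> nat \<Rightarrow> (complex^2^2) pair_pre_digraph" where
  "Gamma2 d N = induced_on (Gamma_M2 d) (\<Union>j \<in> U_set d. S_tc1 j N)"

definition Gamma2_un :: "nat \<Rightarrow> nat \<Rightarrow> (complex^2^2) pair_pre_digraph" where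
  "Gamma2_un d N = mk_symmetric (with_proj (Gamma2 d N))"

subsection \<open>Groups\<close>

definition graph_Aut :: "'a pair_pre_digraph \<Rightarrow> ('a \<Rightarrow> 'a) monoid" where
  "graph_Aut G = BijGroup (pverts G)
     \<lparr>carrier := {f \<in> Bij (pverts G).
        \<forall>u \<in> pverts G. \<forall>v \<in> pverts G. (u, v) \<in> parcs G \<longleftrightarrow> (f u, f v) \<in> parcs G}\<rparr>"

definition semidirect ::
  "('a, 'c) monoid_scheme \<Rightarrow> ('b \<Rightarrow> 'a \<Rightarrow> 'a) \<Rightarrow> ('b, 'd) monoid_scheme \<Rightarrow> ('a \<times> 'b) monoid"
where
  "semidirect N \<phi> H =
     \<lparr>carrier = carrier N \<times> carrier H,
      monoid.mult = (\<lambda>(n, h) (n', h'). (n \<otimes>\<^bsub>N\<^esub> \<phi> h n', h \<otimes>\<^bsub>H\<^esub> h')),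
      one = (\<one>\<^bsub>N\<^esub>, \<one>\<^bsub>H\<^esub>)\<rparr>"

lemma semidirect_group:
  assumes N: "group N" and H: "group H"
    and act: "(\<lambda>h. restrict (\<phi> h) (carrier N)) \<in> hom H (AutoGroup N)"
  shows "group (semidirect N \<phi> H)"
proof -
  interpret N: group N by fact
  interpret H: group H by fact
  have auto: "restrict (\<phi> h) (carrier N) \<in> auto N" if "h \<in> carrier H" for h
    using act that by (auto simp: hom_def AutoGroup_def)
  have Bij: "restrict (\<phi> h) (carrier N) \<in> Bij (carrier N)" if "h \<in> carrier H" for h
    using auto[OF that] by (simp add: auto_def)
  have closed: "\<phi> h x \<in> carrier N" if "h \<in> carrier H" "x \<in> carrier N" for h x
    using auto[OF that(1)] that(2) by (auto simp: auto_def hom_def Pi_iff)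
  have mult: "\<phi> h (x \<otimes>\<^bsub>N\<^esub> y) = \<phi> h x \<otimes>\<^bsub>N\<^esub> \<phi> h y"
    if "h \<in> carrier H" "x \<in> carrier N" "y \<in> carrier N" for h x y
    using auto[OF that(1)] that(2,3) by (auto simp: auto_def hom_def)
  have comp: "\<phi> (h \<otimes>\<^bsub>H\<^esub> k) x = \<phi> h (\<phi> k x)"
    if "h \<in> carrier H" "k \<in> carrier H" "x \<in> carrier N" for h k x
  proof -
    have "restrict (\<phi> (h \<otimes>\<^bsub>H\<^esub> k)) (carrier N) =
          compose (carrier N) (restrict (\<phi> h) (carrier N)) (restrict (\<phi> k) (carrier N))"
      using act that Bij by (auto simp: hom_def AutoGroup_def BijGroup_def)
    from fun_cong[OF this, of x] show ?thesis
      using that closed by (simp add: compose_def)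
  qed
  have one: "\<phi> \<one>\<^bsub>H\<^esub> x = x" if x: "x \<in> carrier N" for x
  proof -
    have inj: "inj_on (restrict (\<phi> \<one>\<^bsub>H\<^esub>) (carrier N)) (carrier N)"
      using Bij[of "\<one>\<^bsub>H\<^esub>"] by (auto simp: Bij_def bij_betw_def)
    have "\<phi> \<one>\<^bsub>H\<^esub> (\<phi> \<one>\<^bsub>H\<^esub> x) = \<phi> \<one>\<^bsub>H\<^esub> x"
      using comp[of "\<one>\<^bsub>H\<^esub>" "\<one>\<^bsub>H\<^esub>" x] x by simp
    with inj x closed[of "\<one>\<^bsub>H\<^esub>" x] show ?thesis by (auto simp: inj_on_def)
  qed
  show ?thesis
  proof (rule groupI)
    fix x assume "x \<in> carrier (semidirect N \<phi> H)"
    then obtain n h where x: "x = (n, h)" "n \<in> carrier N" "h \<in> carrier H"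
      by (auto simp: semidirect_def)
    let ?y = "(\<phi> (inv\<^bsub>H\<^esub> h) (inv\<^bsub>N\<^esub> n), inv\<^bsub>H\<^esub> h)"
    have "\<phi> (inv\<^bsub>H\<^esub> h) \<one>\<^bsub>N\<^esub> = \<one>\<^bsub>N\<^esub>"
      using mult[of "inv\<^bsub>H\<^esub> h" "\<one>\<^bsub>N\<^esub>" "\<one>\<^bsub>N\<^esub>"] closed[of "inv\<^bsub>H\<^esub> h" "\<one>\<^bsub>N\<^esub>"] x
      by simp
    then show "\<exists>y\<in>carrier (semidirect N \<phi> H).
        y \<otimes>\<^bsub>semidirect N \<phi> H\<^esub> x = \<one>\<^bsub>semidirect N \<phi> H\<^esub>"
      using x closed mult[of "inv\<^bsub>H\<^esub> h" "inv\<^bsub>N\<^esub> n" n]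
      by (intro bexI[of _ ?y]) (auto simp: semidirect_def)
  qed (auto simp: semidirect_def closed mult comp one N.m_assoc H.m_assoc)
qed

abbreviation C2 :: "int monoid" where
  "C2 \<equiv> integer_mod_group 2"

definition swap_action :: "int \<Rightarrow> 'a \<times> 'a \<Rightarrow> 'a \<times> 'a" where
  "swap_action k = (\<lambda>(x, y). if k = 0 then (x, y) else (y, x))"

lemma swap_action_hom:
  assumes "group G"
  shows "(\<lambda>k. restrict (swap_action k) (carrier (G \<times>\<times> G))) \<in> hom C2 (AutoGroup (G \<times>\<times> G))"
proof -
  let ?r = "\<lambda>k. restrict (swap_action k) (carrier (G \<times>\<times> G))"
  have cl: "swap_action k x \<in> carrier (G \<times>\<times> G)" if "x \<in> carrier (G \<times>\<times> G)" for k x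
    using that by (auto simp: swap_action_def)
  have inv: "swap_action k (swap_action k x) = x" for k and x :: "'a \<times> 'a"
    by (cases x) (simp add: swap_action_def)
  have bij: "bij_betw (swap_action k) (carrier (G \<times>\<times> G)) (carrier (G \<times>\<times> G))" for k
    by (rule bij_betw_byWitness[where f' = "swap_action k"])
       (use cl inv in \<open>auto simp del: carrier_DirProd\<close>)
  have Bij: "?r k \<in> Bij (carrier (G \<times>\<times> G))" for k
    using bij[of k] by (simp add: Bij_def del: carrier_DirProd cong: bij_betw_cong)
  interpret G: group G by fact
  have "?r k \<in> hom (G \<times>\<times> G) (G \<times>\<times> G)" for k
    by (auto simp: hom_def swap_action_def)
  with Bij have auto: "?r k \<in> auto (G \<times>\<times> G)" for k
    by (simp add: auto_def)
  have carr: "carrier C2 = {0, 1}"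
    by (auto simp: integer_mod_group_def)
  show ?thesis
  proof (rule homI)
    fix k assume "k \<in> carrier C2"
    then show "?r k \<in> carrier (AutoGroup (G \<times>\<times> G))"
      using auto by (simp add: AutoGroup_def)
  next
    fix k l assume kl: "k \<in> carrier C2" "l \<in> carrier C2"
    have "?r (k \<otimes>\<^bsub>C2\<^esub> l) = compose (carrier (G \<times>\<times> G)) (?r k) (?r l)"
      using kl unfolding carr
      by (auto simp: fun_eq_iff compose_def swap_action_def integer_mod_group_def)
    then show "?r (k \<otimes>\<^bsub>C2\<^esub> l) = ?r k \<otimes>\<^bsub>AutoGroup (G \<times>\<times> G)\<^esub> ?r l"
      using Bij by (simp add: AutoGroup_def BijGroup_def)
  qed
qed

text \<open>
  A permutation \<open>\<sigma>\<close> of \<open>{1, 2, 3}\<close> moves the entry at position \<open>i\<close> to position \<open>\<sigma> i\<close>,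
  which is a left action.
\<close>

definition perm3_action :: "(nat \<Rightarrow> nat) \<Rightarrow> 'a \<times> 'a \<times> 'a \<Rightarrow> 'a \<times> 'a \<times> 'a" where
  "perm3_action \<sigma> = (\<lambda>(x1, x2, x3).
     let x = (\<lambda>i. if i = 1 then x1 else if i = 2 then x2 else x3);
         \<tau> = inv_into UNIV \<sigma>
     in (x (\<tau> 1), x (\<tau> 2), x (\<tau> 3)))"

lemma perm3_action_hom:
  assumes "group G"
  shows "(\<lambda>\<sigma>. restrict (perm3_action \<sigma>) (carrier (G \<times>\<times> G \<times>\<times> G)))
           \<in> hom (sym_group 3) (AutoGroup (G \<times>\<times> G \<times>\<times> G))"
proof -
  let ?C = "carrier (G \<times>\<times> G \<times>\<times> G)"
  let ?r = "\<lambda>\<sigma>. restrict (perm3_action \<sigma>) ?C"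
  interpret G: group G by fact
  have cl: "perm3_action \<sigma> x \<in> ?C" if "x \<in> ?C" for \<sigma> x
    using that by (auto simp: perm3_action_def Let_def)
  have idx: "inv_into UNIV \<sigma> i = 1 \<or> inv_into UNIV \<sigma> i = 2 \<or> inv_into UNIV \<sigma> i = 3"
    if "\<sigma> permutes {1..3::nat}" "i \<in> {1, 2, 3}" for \<sigma> i
  proof -
    have "inv_into UNIV \<sigma> i \<in> {1..3}"
      using permutes_in_image[OF permutes_inv[OF that(1)], of i] that(2) by auto
    then show ?thesis by auto
  qed
  define get :: "'a \<times> 'a \<times> 'a \<Rightarrow> nat \<Rightarrow> 'a"
    where "get = (\<lambda>(x1, x2, x3) i. if i = 1 then x1 else if i = 2 then x2 else x3)"
  have act: "perm3_action \<sigma> x = (get x (inv_into UNIV \<sigma> 1), get x (inv_into UNIV \<sigma> 2),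
      get x (inv_into UNIV \<sigma> 3))" for \<sigma> x
    by (cases x) (simp only: perm3_action_def get_def Let_def prod.case)
  have get: "get (a, b, c) 1 = a" "get (a, b, c) 2 = b" "get (a, b, c) 3 = c" for a b c
    by (simp_all add: get_def)
  have get_act: "get (perm3_action \<sigma> x) i = get x (inv_into UNIV \<sigma> i)"
    if "i = 1 \<or> i = 2 \<or> i = 3" for \<sigma> x i
    using that by (elim disjE) (simp_all only: act get)
  have comp: "perm3_action (\<sigma> \<circ> \<rho>) x = perm3_action \<sigma> (perm3_action \<rho> x)"
    if "\<sigma> permutes {1..3}" "\<rho> permutes {1..3}" for \<sigma> \<rho> and x :: "'a \<times> 'a \<times> 'a"
  proof -
    have *: "inv_into UNIV (\<sigma> \<circ> \<rho>) i = inv_into UNIV \<rho> (inv_into UNIV \<sigma> i)" for i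
      using that by (simp add: o_inv_distrib permutes_bij)
    have **: "get (perm3_action \<rho> x) (inv_into UNIV \<sigma> i) = get x (inv_into UNIV (\<sigma> \<circ> \<rho>) i)"
      if "i \<in> {1, 2, 3}" for i
      unfolding * by (rule get_act) (rule idx[OF \<open>\<sigma> permutes {1..3}\<close> that])
    show ?thesis
      unfolding act[of "\<sigma> \<circ> \<rho>" x] act[of \<sigma> "perm3_action \<rho> x"]
      by (simp only: ** insert_iff simp_thms)
  qed
  have one: "perm3_action id x = x" for x :: "'a \<times> 'a \<times> 'a"
    by (cases x) (simp add: perm3_action_def)
  have bij: "bij_betw (perm3_action \<sigma>) ?C ?C" if "\<sigma> permutes {1..3}" for \<sigma>
  proof (rule bij_betw_byWitness[where f' = "perm3_action (inv_into UNIV \<sigma>)"])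
    show "\<forall>x\<in>?C. perm3_action (inv_into UNIV \<sigma>) (perm3_action \<sigma> x) = x"
      using comp[OF permutes_inv[OF that] that, symmetric]
      by (simp only: permutes_inv_o[OF that] one) blast
    show "\<forall>x\<in>?C. perm3_action \<sigma> (perm3_action (inv_into UNIV \<sigma>) x) = x"
      using comp[OF that permutes_inv[OF that], symmetric]
      by (simp only: permutes_inv_o[OF that] one) blast
  qed (use cl in blast)+
  have Bij: "?r \<sigma> \<in> Bij ?C" if "\<sigma> permutes {1..3}" for \<sigma>
    using bij[OF that] by (simp add: Bij_def del: carrier_DirProd cong: bij_betw_cong)
  have "?r \<sigma> \<in> hom (G \<times>\<times> G \<times>\<times> G) (G \<times>\<times> G \<times>\<times> G)" for \<sigma>
    by (auto simp: hom_def perm3_action_def Let_def)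
  with Bij have auto: "?r \<sigma> \<in> auto (G \<times>\<times> G \<times>\<times> G)" if "\<sigma> permutes {1..3}" for \<sigma>
    using that by (simp add: auto_def)
  show ?thesis
  proof (rule homI)
    fix \<sigma> assume "\<sigma> \<in> carrier (sym_group 3)"
    then show "?r \<sigma> \<in> carrier (AutoGroup (G \<times>\<times> G \<times>\<times> G))"
      using auto by (simp add: AutoGroup_def sym_group_def)
  next
    fix \<sigma> \<rho> assume "\<sigma> \<in> carrier (sym_group 3)" "\<rho> \<in> carrier (sym_group 3)"
    then have p: "\<sigma> permutes {1..3}" "\<rho> permutes {1..3}" by (auto simp: sym_group_def)
    have "?r (\<sigma> \<circ> \<rho>) = compose ?C (?r \<sigma>) (?r \<rho>)"
      using cl by (auto simp: fun_eq_iff compose_def comp[OF p] simp del: carrier_DirProd)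
    then show "?r (\<sigma> \<otimes>\<^bsub>sym_group 3\<^esub> \<rho>) = ?r \<sigma> \<otimes>\<^bsub>AutoGroup (G \<times>\<times> G \<times>\<times> G)\<^esub> ?r \<rho>"
      using Bij p by (simp add: AutoGroup_def BijGroup_def sym_group_def)
  qed
qed

end

theory Submission
  imports Defs
begin

text \<open>
  Write \<open>T\<^sub>t\<close> for the matrix with rows \<open>(1, t)\<close> and \<open>(t\<^sup>2, t\<^sup>3)\<close>. It is the rank-one product of the
  column \<open>(1, t\<^sup>2)\<close> and the row \<open>(1, t)\<close>, so nonzero multiples of \<open>T\<^sub>s\<close> and \<open>T\<^sub>t\<close> multiply to
  zero exactly when \<open>s t\<^sup>2 = -1\<close>. Hence each graph is a blow-up of a small graph with loops:
  every index \<open>i\<close> is replaced by a class of \<open>m i \<ge> 2\<close> vertices, which is a clique if \<open>i\<close>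
  carries a loop and an independent set otherwise. The rows of the small adjacency matrices are
  pairwise distinct, so the classes are precisely the classes of twin vertices, and every
  automorphism permutes them. The automorphism group is therefore the semidirect product of
  the symmetric groups on the classes by the group of those automorphisms of the small graph
  that preserve loops and class sizes. The small graphs are an edge without loops; an edge with
  a loop at one end; for \<open>d = 1\<close> a path on three vertices with a loop at one end; and for
  \<open>d = 3\<close> three disjoint copies of the looped edge.
\<close>

subsection \<open>Automorphisms of blow-ups\<close>

text \<open>The fibre over \<open>i\<close> is literally \<open>{1..m i}\<close>, so that its
  permutations are the elements of \<open>sym_group (m i)\<close>.\<close>

definition blowup :: "'i set \<Rightarrow> ('i \<Rightarrow> nat) \<Rightarrow> ('i \<Rightarrow> 'i \<Rightarrow> bool) \<Rightarrow> ('i \<times> nat) pair_pre_digraph" where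
  "blowup I m A =
     \<lparr>pverts = (SIGMA i:I. {1..m i}),
      parcs = {(u, v). u \<in> (SIGMA i:I. {1..m i}) \<and> v \<in> (SIGMA i:I. {1..m i})
                        \<and> u \<noteq> v \<and> A (fst u) (fst v)}\<rparr>"

lemma pverts_blowup: "pverts (blowup I m A) = (SIGMA i:I. {1..m i})"
  by (simp add: blowup_def)

lemma parcs_blowup:
  "(u, v) \<in> parcs (blowup I m A) \<longleftrightarrow>
     u \<in> pverts (blowup I m A) \<and> v \<in> pverts (blowup I m A) \<and> u \<noteq> v \<and> A (fst u) (fst v)"
  by (simp add: blowup_def)

text \<open>Only values on \<open>I\<close> are constrained, so one automorphism of the small graph
  may have many representatives; they are compared only on \<open>I\<close>.\<close>

definition weighted_auts :: "'i set \<Rightarrow> ('i \<Rightarrow> nat) \<Rightarrow> ('i \<Rightarrow> 'i \<Rightarrow> bool) \<Rightarrow> ('i \<Rightarrow> 'i) set" where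
  "weighted_auts I m A =
     {h. bij_betw h I I \<and> (\<forall>i\<in>I. m (h i) = m i) \<and> (\<forall>i\<in>I. \<forall>j\<in>I. A (h i) (h j) \<longleftrightarrow> A i j)}"

lemma weighted_auts_id: "(\<lambda>i. i) \<in> weighted_auts I m A"
  by (auto simp: weighted_auts_def bij_betw_def)

lemma weighted_autsD:
  assumes "h \<in> weighted_auts I m A"
  shows "inj_on h I" "i \<in> I \<Longrightarrow> h i \<in> I"
    "i \<in> I \<Longrightarrow> j \<in> I \<Longrightarrow> A (h i) (h j) \<longleftrightarrow> A i j"
  using assms by (auto simp: weighted_auts_def bij_betw_def)

section \<open>Automorphism groups and bijections of vertices\<close>

lemma graph_Aut_mult:
  assumes "f \<in> carrier (graph_Aut G)" "g \<in> carrier (graph_Aut G)"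
  shows "f \<otimes>\<^bsub>graph_Aut G\<^esub> g = compose (pverts G) f g"
  using assms by (simp add: graph_Aut_def BijGroup_def)

lemma graph_Aut_carrier:
  "f \<in> carrier (graph_Aut G) \<longleftrightarrow>
     f \<in> extensional (pverts G) \<and> bij_betw f (pverts G) (pverts G) \<and>
     (\<forall>u \<in> pverts G. \<forall>v \<in> pverts G. (u, v) \<in> parcs G \<longleftrightarrow> (f u, f v) \<in> parcs G)"
  by (simp add: graph_Aut_def Bij_def)

text \<open>Conjugation by \<open>e\<close> is the isomorphism; conjugates are restricted to the
  vertex set because elements of \<open>Bij\<close> are extensional.\<close>

lemma graph_Aut_isoI:
  assumes e: "bij_betw e (pverts G) (pverts H)"
    and arcs: "\<And>u v. u \<in> pverts G \<Longrightarrow> v \<in> pverts G \<Longrightarrow>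
      (e u, e v) \<in> parcs H \<longleftrightarrow> (u, v) \<in> parcs G"
  shows "graph_Aut H \<cong> graph_Aut G"
proof -
  let ?V = "pverts G" and ?W = "pverts H"
  define e' where "e' = inv_into ?V e"
  have e': "bij_betw e' ?W ?V"
    unfolding e'_def using e by (rule bij_betw_inv_into)
  have e'e: "e' (e u) = u" if "u \<in> ?V" for u
    unfolding e'_def using e that by (rule bij_betw_inv_into_left)
  have ee': "e (e' w) = w" if "w \<in> ?W" for w
    unfolding e'_def using e that by (rule bij_betw_inv_into_right)
  have eW: "e u \<in> ?W" if "u \<in> ?V" for u using e that by (rule bij_betwE[rule_format])
  have eV: "e' w \<in> ?V" if "w \<in> ?W" for w using e' that by (rule bij_betwE[rule_format])
  have arcs': "(e' w, e' x) \<in> parcs G \<longleftrightarrow> (w, x) \<in> parcs H" if "w \<in> ?W" "x \<in> ?W" for w x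
    using arcs[OF eV eV, OF that] that by (simp add: ee')
  define F where "F = (\<lambda>f. restrict (e \<circ> f \<circ> e') ?W)"
  define F' where "F' = (\<lambda>g. restrict (e' \<circ> g \<circ> e) ?V)"
  have fV: "f u \<in> ?V" if "f \<in> carrier (graph_Aut G)" "u \<in> ?V" for f u
    using that by (auto simp: graph_Aut_carrier dest: bij_betwE)
  have gW: "g w \<in> ?W" if "g \<in> carrier (graph_Aut H)" "w \<in> ?W" for g w
    using that by (auto simp: graph_Aut_carrier dest: bij_betwE)
  have F: "F f \<in> carrier (graph_Aut H)" if f: "f \<in> carrier (graph_Aut G)" for f
  proof -
    have "bij_betw (e \<circ> f \<circ> e') ?W ?W"
      using f e e' by (auto simp: graph_Aut_carrier intro!: bij_betw_trans)
    moreover have "(w, x) \<in> parcs H \<longleftrightarrow> (e (f (e' w)), e (f (e' x))) \<in> parcs H"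
      if "w \<in> ?W" "x \<in> ?W" for w x
      using that f by (simp add: arcs fV eV arcs'[symmetric]) (simp add: graph_Aut_carrier eV)
    ultimately show ?thesis
      by (simp add: graph_Aut_carrier F_def cong: bij_betw_cong)
  qed
  have F': "F' g \<in> carrier (graph_Aut G)" if g: "g \<in> carrier (graph_Aut H)" for g
  proof -
    have "bij_betw (e' \<circ> g \<circ> e) ?V ?V"
      using g e e' by (auto simp: graph_Aut_carrier intro!: bij_betw_trans)
    moreover have "(w, x) \<in> parcs G \<longleftrightarrow> (e' (g (e w)), e' (g (e x))) \<in> parcs G"
      if "w \<in> ?V" "x \<in> ?V" for w x
      using that g by (simp add: arcs' gW eW arcs[symmetric]) (simp add: graph_Aut_carrier eW)
    ultimately show ?thesis
      by (simp add: graph_Aut_carrier F'_def cong: bij_betw_cong)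
  qed
  have "F' \<in> iso (graph_Aut H) (graph_Aut G)"
  proof (rule isoI)
    show "F' \<in> hom (graph_Aut H) (graph_Aut G)"
    proof (rule homI)
      fix f g assume fg: "f \<in> carrier (graph_Aut H)" "g \<in> carrier (graph_Aut H)"
      have "F' (compose ?W f g) = compose ?V (F' f) (F' g)"
        using gW[OF fg(2)] by (auto simp: F'_def compose_def fun_eq_iff eV eW ee')
      then show "F' (f \<otimes>\<^bsub>graph_Aut H\<^esub> g) = F' f \<otimes>\<^bsub>graph_Aut G\<^esub> F' g"
        using fg F' by (simp add: graph_Aut_mult)
    qed (rule F')
    show "bij_betw F' (carrier (graph_Aut H)) (carrier (graph_Aut G))"
    proof (rule bij_betw_byWitness[where f' = F])
      show "\<forall>f\<in>carrier (graph_Aut G). F' (F f) = f"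
      proof
        fix f assume f: "f \<in> carrier (graph_Aut G)"
        then have "f \<in> extensional ?V" by (simp add: graph_Aut_carrier)
        then show "F' (F f) = f"
          using fV[OF f] by (auto simp: F_def F'_def fun_eq_iff eW e'e extensional_def)
      qed
      show "\<forall>g\<in>carrier (graph_Aut H). F (F' g) = g"
      proof
        fix g assume g: "g \<in> carrier (graph_Aut H)"
        then have "g \<in> extensional ?W" by (simp add: graph_Aut_carrier)
        then show "F (F' g) = g"
          using gW[OF g] by (auto simp: F_def F'_def fun_eq_iff eV ee' extensional_def)
      qed
    qed (use F F' in auto)
  qed
  then show ?thesis by (rule is_isoI)
qed

text \<open>Enumerating each class by \<open>{1..m i}\<close> gives a vertex bijection, injective
  because the classes are disjoint. Adjacency of distinct vertices depends only on their classes, so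
  any enumeration will do.\<close>

lemma graph_Aut_iso_blowup:
  assumes fin: "\<And>i. i \<in> I \<Longrightarrow> finite (V i)"
    and card: "\<And>i. i \<in> I \<Longrightarrow> card (V i) = m i"
    and disj: "disjoint_family_on V I"
    and verts: "pverts G = (\<Union>i\<in>I. V i)"
    and arcs: "\<And>i j u v. i \<in> I \<Longrightarrow> j \<in> I \<Longrightarrow> u \<in> V i \<Longrightarrow> v \<in> V j \<Longrightarrow>
      (u, v) \<in> parcs G \<longleftrightarrow> u \<noteq> v \<and> A i j"
  shows "graph_Aut G \<cong> graph_Aut (blowup I m A)"
proof -
  have "\<forall>i\<in>I. \<exists>b. bij_betw b {1..m i} (V i)"
    using fin card by (intro ballI finite_same_card_bij) auto
  then obtain b where b: "\<And>i. i \<in> I \<Longrightarrow> bij_betw (b i) {1..m i} (V i)" by metis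
  define e where "e = (\<lambda>(i, k). b i k)"
  have inV: "b i k \<in> V i" if "i \<in> I" "k \<in> {1..m i}" for i k
    using b[OF that(1)] that(2) by (auto dest: bij_betwE)
  have inj: "inj_on e (SIGMA i:I. {1..m i})"
  proof (rule inj_onI, clarify)
    fix i k j l assume *: "i \<in> I" "j \<in> I" "k \<in> {1..m i}" "l \<in> {1..m j}" "e (i, k) = e (j, l)"
    then have eq: "b i k = b j l" by (simp add: e_def)
    have "V i \<inter> V j \<noteq> {}" using inV[OF *(1,3)] inV[OF *(2,4)] unfolding eq by blast
    then have "i = j" using disj *(1,2) unfolding disjoint_family_on_def by blast
    moreover have "k = l"
      using inj_onD[OF bij_betw_imp_inj_on[OF b[OF *(1)]], of k l] *(3,4) eq \<open>i = j\<close> by simp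
    ultimately show "i = j \<and> k = l" by simp
  qed
  have img: "e ` (SIGMA i:I. {1..m i}) = pverts G"
  proof
    show "e ` (SIGMA i:I. {1..m i}) \<subseteq> pverts G"
      using inV by (auto simp: verts e_def)
    show "pverts G \<subseteq> e ` (SIGMA i:I. {1..m i})"
    proof
      fix v assume "v \<in> pverts G"
      then obtain i where i: "i \<in> I" "v \<in> V i" by (auto simp: verts)
      then obtain k where "k \<in> {1..m i}" "v = b i k"
        using bij_betw_imp_surj_on[OF b[OF i(1)]] by blast
      with i show "v \<in> e ` (SIGMA i:I. {1..m i})"
        by (intro image_eqI[of _ _ "(i, k)"]) (auto simp: e_def)
    qed
  qed
  show ?thesis
  proof (rule graph_Aut_isoI)
    show "bij_betw e (pverts (blowup I m A)) (pverts G)"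
      using inj img by (simp add: bij_betw_def pverts_blowup)
    fix u v assume uv: "u \<in> pverts (blowup I m A)" "v \<in> pverts (blowup I m A)"
    then have "e u \<in> V (fst u)" "e v \<in> V (fst v)" "fst u \<in> I" "fst v \<in> I"
      by (auto simp: pverts_blowup e_def intro!: inV)
    moreover have "e u = e v \<longleftrightarrow> u = v"
      using inj uv by (simp add: inj_on_eq_iff pverts_blowup)
    ultimately show "(e u, e v) \<in> parcs G \<longleftrightarrow> (u, v) \<in> parcs (blowup I m A)"
      using uv by (simp add: arcs parcs_blowup)
  qed
qed

section \<open>Blow-ups whose fibres are the twin classes\<close>

locale reduced_blowup =
  fixes I :: "'i set" and m :: "'i \<Rightarrow> nat" and A :: "'i \<Rightarrow> 'i \<Rightarrow> bool"
  assumes finite_I: "finite I"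
    and two_le: "i \<in> I \<Longrightarrow> 2 \<le> m i"
    and rows_distinct: "i \<in> I \<Longrightarrow> j \<in> I \<Longrightarrow> (\<And>l. l \<in> I \<Longrightarrow> A i l \<longleftrightarrow> A j l) \<Longrightarrow> i = j"
begin

abbreviation "B \<equiv> blowup I m A"
abbreviation "V \<equiv> pverts B"

text \<open>The vertices \<open>u\<close> and \<open>v\<close> themselves are left out as test
  vertices: no vertex has an arc to itself, so two members of a clique would otherwise be told
  apart. Comparing outgoing arcs matches the rows of \<open>A\<close>.\<close>

definition twins :: "'i \<times> nat \<Rightarrow> 'i \<times> nat \<Rightarrow> bool" where
  "twins u v \<longleftrightarrow> (\<forall>w\<in>V. w \<noteq> u \<longrightarrow> w \<noteq> v \<longrightarrow> ((u, w) \<in> parcs B \<longleftrightarrow> (v, w) \<in> parcs B))"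

text \<open>This makes the partition into fibres visible in the graph alone. Vertices of one fibre
  share a row of \<open>A\<close>; for different fibres some column separates the rows.\<close>

lemma twins_iff:
  assumes u: "u \<in> V" and v: "v \<in> V"
  shows "twins u v \<longleftrightarrow> fst u = fst v"
proof
  assume "fst u = fst v"
  then show "twins u v" using u v by (auto simp: twins_def parcs_blowup)
next
  assume tw: "twins u v"
  show "fst u = fst v"
  proof (rule ccontr)
    assume ne: "fst u \<noteq> fst v"
    have "fst u \<in> I" "fst v \<in> I" using u v by (auto simp: pverts_blowup)
    then obtain l where l: "l \<in> I" "A (fst u) l \<noteq> A (fst v) l"
      using rows_distinct ne by blast
    \<comment> \<open>at most one of \<open>u\<close>, \<open>v\<close> lies over \<open>l\<close>, so \<open>m l \<ge> 2\<close> leaves room for a witness\<close>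
    have "\<exists>k\<in>{1..m l}. (l, k) \<noteq> u \<and> (l, k) \<noteq> v"
    proof (rule ccontr)
      assume "\<not> ?thesis"
      then have "(l, 1) = u \<or> (l, 1) = v" "(l, 2) = u \<or> (l, 2) = v"
        using two_le[OF l(1)] by auto
      then show False using ne by auto
    qed
    then obtain k where k: "k \<in> {1..m l}" "(l, k) \<noteq> u" "(l, k) \<noteq> v" by blast
    then have w: "(l, k) \<in> V" using l by (simp add: pverts_blowup)
    with tw k have "(u, (l, k)) \<in> parcs B \<longleftrightarrow> (v, (l, k)) \<in> parcs B"
      by (auto simp: twins_def)
    then show False using w k l u v by (auto simp: parcs_blowup)
  qed
qed

text \<open>An automorphism preserves the twin relation, hence permutes the fibres, and
  \<open>h\<close> is the induced map of indices. The permutation \<open>\<sigma>\<close> is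
  attached to the target fibre, which is the form used in \<open>Aut_iso\<close>.\<close>

lemma aut_cases:
  assumes f: "f \<in> carrier (graph_Aut B)"
  obtains h \<sigma> where "h \<in> weighted_auts I m A"
    and "\<And>i. i \<in> I \<Longrightarrow> \<sigma> i permutes {1..m i}"
    and "\<And>i k. (i, k) \<in> V \<Longrightarrow> f (i, k) = (h i, \<sigma> (h i) k)"
proof -
  have bij: "bij_betw f V V"
    and arc: "\<And>u v. u \<in> V \<Longrightarrow> v \<in> V \<Longrightarrow> (f u, f v) \<in> parcs B \<longleftrightarrow> (u, v) \<in> parcs B"
    using f by (auto simp: graph_Aut_carrier)
  have fV: "f u \<in> V" if "u \<in> V" for u using bij that by (auto dest: bij_betwE)
  have feq: "f u = f v \<longleftrightarrow> u = v" if "u \<in> V" "v \<in> V" for u v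
    using bij that by (auto simp: bij_betw_def inj_on_def)
  have fsurj: "\<exists>u\<in>V. w = f u" if "w \<in> V" for w
    using bij that by (auto simp: bij_betw_def)
  have tw: "twins (f u) (f v) \<longleftrightarrow> twins u v" if uv: "u \<in> V" "v \<in> V" for u v
  proof -
    \<comment> \<open>Quantifying over the image of \<open>f\<close> instead of \<open>V\<close>
      allows every condition to be pulled back along \<open>f\<close>.\<close>
    have "twins (f u) (f v) \<longleftrightarrow>
        (\<forall>w\<in>f ` V. w \<noteq> f u \<longrightarrow> w \<noteq> f v \<longrightarrow> ((f u, w) \<in> parcs B \<longleftrightarrow> (f v, w) \<in> parcs B))"
      unfolding twins_def bij_betw_imp_surj_on[OF bij] ..
    also have "\<dots> \<longleftrightarrow> twins u v"
      unfolding twins_def using uv by (simp add: feq arc)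
    finally show ?thesis .
  qed
  have fsteq: "fst (f u) = fst (f v) \<longleftrightarrow> fst u = fst v" if "u \<in> V" "v \<in> V" for u v
    using tw[OF that] twins_iff[OF that] twins_iff[OF fV fV, OF that] by simp
  have V1: "(i, 1) \<in> V" and V2: "(i, 2) \<in> V" if "i \<in> I" for i
    using two_le[OF that] that by (auto simp: pverts_blowup)
  define h where "h = (\<lambda>i. fst (f (i, 1)))"
  have fst_f: "fst (f u) = h (fst u)" if "u \<in> V" for u
    using fsteq[OF that V1, of "fst u"] that by (auto simp: h_def pverts_blowup)
  have hI: "h i \<in> I" if "i \<in> I" for i
    using fV[OF V1[OF that]] by (auto simp: h_def pverts_blowup)
  have "inj_on h I"
    using fsteq[OF V1 V1] by (auto simp: h_def inj_on_def)
  moreover from this have "h ` I = I"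
    using hI by (intro endo_inj_surj finite_I) auto
  ultimately have h: "bij_betw h I I" by (simp add: bij_betw_def)
  \<comment> \<open>Injectivity of \<open>h\<close> puts every preimage of a vertex over
    \<open>h i\<close> into the fibre over \<open>i\<close>. Comparing cardinalities then shows that
    \<open>h\<close> preserves \<open>m\<close>.\<close>
  have fib: "bij_betw (\<lambda>k. snd (f (i, k))) {1..m i} {1..m (h i)}" if i: "i \<in> I" for i
  proof (rule bij_betwI')
    fix k assume k: "k \<in> {1..m i}"
    then show "snd (f (i, k)) \<in> {1..m (h i)}"
      using fV[of "(i, k)"] fst_f[of "(i, k)"] i by (auto simp: pverts_blowup)
    fix l assume l: "l \<in> {1..m i}"
    show "snd (f (i, k)) = snd (f (i, l)) \<longleftrightarrow> k = l"
      using feq[of "(i, k)" "(i, l)"] fst_f[of "(i, k)"] fst_f[of "(i, l)"] i k l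
      by (auto simp: pverts_blowup prod_eq_iff)
  next
    fix l assume l: "l \<in> {1..m (h i)}"
    then obtain u where u: "u \<in> V" "(h i, l) = f u"
      using fsurj[of "(h i, l)"] hI[OF i] by (auto simp: pverts_blowup)
    then have "h (fst u) = h i" using fst_f[of u] by (metis fst_conv)
    then have "fst u = i" using \<open>inj_on h I\<close> i u by (auto simp: inj_on_def pverts_blowup)
    then obtain k where k: "u = (i, k)" by (cases u) simp
    have "l = snd (f (i, k))" using u(2) unfolding k by (metis snd_conv)
    then show "\<exists>k\<in>{1..m i}. l = snd (f (i, k))"
      using u(1) unfolding k by (auto simp: pverts_blowup)
  qed
  have m_h: "m (h i) = m i" if "i \<in> I" for i
    using bij_betw_same_card[OF fib[OF that]] by simp
  have A_h: "A (h i) (h j) \<longleftrightarrow> A i j" if "i \<in> I" "j \<in> I" for i j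
  proof -
    \<comment> \<open>The labels 1 and 2 make the two vertices distinct even for
      \<open>i = j\<close>, so preservation of loops is covered as well.\<close>
    let ?u = "(i, 1)" and ?v = "(j, 2)"
    have uv: "?u \<in> V" "?v \<in> V" using V1 V2 that by auto
    have "fst (f ?u) = h i" "fst (f ?v) = h j" using fst_f[OF uv(1)] fst_f[OF uv(2)] by auto
    moreover have "f ?u \<noteq> f ?v" using feq[OF uv] by simp
    ultimately show ?thesis
      using arc[OF uv] fV[OF uv(1)] fV[OF uv(2)] uv by (simp add: parcs_blowup)
  qed
  have h': "inv_into I h (h i) = i" "h (inv_into I h i) = i" "inv_into I h i \<in> I"
    if "i \<in> I" for i
    using that h by (auto simp: bij_betw_inv_into_left bij_betw_inv_into_right
        intro!: bij_betwE[OF bij_betw_inv_into, rule_format])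
  \<comment> \<open>The source fibre is found by inverting \<open>h\<close>; off the fibre
    \<open>permutes\<close> demands the identity.\<close>
  define \<sigma> where "\<sigma> = (\<lambda>j k. if k \<in> {1..m j} then snd (f (inv_into I h j, k)) else k)"
  show ?thesis
  proof (rule that)
    show "h \<in> weighted_auts I m A"
      using h m_h A_h by (simp add: weighted_auts_def)
    fix j assume j: "j \<in> I"
    have "bij_betw (\<lambda>k. snd (f (inv_into I h j, k))) {1..m j} {1..m j}"
      using fib[OF h'(3)[OF j]] m_h[OF h'(3)[OF j]] h'(2)[OF j] by simp
    then have "bij_betw (\<sigma> j) {1..m j} {1..m j}"
      by (rule bij_betw_cong[THEN iffD1, rotated]) (simp add: \<sigma>_def)
    then show "\<sigma> j permutes {1..m j}"
      by (rule bij_imp_permutes) (auto simp: \<sigma>_def)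
  next
    fix i k assume ik: "(i, k) \<in> V"
    then show "f (i, k) = (h i, \<sigma> (h i) k)"
      using fst_f[of "(i, k)"]
      by (auto simp: \<sigma>_def pverts_blowup h' m_h prod_eq_iff)
  qed
qed

text \<open>
  The action of \<open>x\<close> sends \<open>(i, k)\<close> to \<open>(\<pi> x i, \<nu> x (\<pi> x i) k)\<close>; the hypothesis \<open>mult\<close>
  is the multiplication rule of the semidirect product of the permutations of the fibres by
  the permutations of the index set.
\<close>

lemma Aut_iso:
  fixes G :: "('g, 'h) monoid_scheme"
    and \<pi> :: "'g \<Rightarrow> 'i \<Rightarrow> 'i" and \<nu> :: "'g \<Rightarrow> 'i \<Rightarrow> nat \<Rightarrow> nat"
  assumes "group G"
    and \<pi>: "\<And>x. x \<in> carrier G \<Longrightarrow> \<pi> x \<in> weighted_auts I m A"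
    and \<nu>: "\<And>x i. x \<in> carrier G \<Longrightarrow> i \<in> I \<Longrightarrow> \<nu> x i permutes {1..m i}"
    and mult: "\<And>x y i. x \<in> carrier G \<Longrightarrow> y \<in> carrier G \<Longrightarrow> i \<in> I \<Longrightarrow>
      \<pi> (x \<otimes>\<^bsub>G\<^esub> y) i = \<pi> x (\<pi> y i) \<and> \<nu> (x \<otimes>\<^bsub>G\<^esub> y) (\<pi> x i) = \<nu> x (\<pi> x i) \<circ> \<nu> y i"
    and inj: "\<And>x y. x \<in> carrier G \<Longrightarrow> y \<in> carrier G \<Longrightarrow>
      (\<And>i. i \<in> I \<Longrightarrow> \<pi> x i = \<pi> y i \<and> \<nu> x i = \<nu> y i) \<Longrightarrow> x = y"
    and surj: "\<And>h \<sigma>. h \<in> weighted_auts I m A \<Longrightarrow> (\<And>i. i \<in> I \<Longrightarrow> \<sigma> i permutes {1..m i}) \<Longrightarrow>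
      \<exists>x\<in>carrier G. \<forall>i\<in>I. \<pi> x i = h i \<and> \<nu> x i = \<sigma> i"
  shows "graph_Aut B \<cong> G"
proof -
  define F where "F = (\<lambda>x. \<lambda>(i, k)\<in>V. (\<pi> x i, \<nu> x (\<pi> x i) k))"
  have F_app: "F x (i, k) = (\<pi> x i, \<nu> x (\<pi> x i) k)" if "(i, k) \<in> V" for x i k
    using that by (simp add: F_def)
  have \<pi>I: "\<pi> x i \<in> I" and m\<pi>: "m (\<pi> x i) = m i" and inj\<pi>: "inj_on (\<pi> x) I"
    and surj\<pi>: "\<pi> x ` I = I"
    and A\<pi>: "\<And>j. j \<in> I \<Longrightarrow> A (\<pi> x i) (\<pi> x j) \<longleftrightarrow> A i j"
    if "x \<in> carrier G" "i \<in> I" for x i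
    using \<pi>[OF that(1)] that(2) by (auto simp: weighted_auts_def bij_betw_def)
  have F_V: "F x u \<in> V" if x: "x \<in> carrier G" and u: "u \<in> V" for x u
  proof -
    obtain i k where ik: "u = (i, k)" "i \<in> I" "k \<in> {1..m i}"
      using u by (auto simp: pverts_blowup)
    have "\<nu> x (\<pi> x i) k \<in> {1..m (\<pi> x i)}"
      using permutes_in_image[OF \<nu>[OF x \<pi>I[OF x ik(2)]], of k] ik(3) m\<pi>[OF x ik(2)] by simp
    then show ?thesis
      using ik u \<pi>I[OF x ik(2)] by (simp add: F_app) (simp add: pverts_blowup)
  qed
  have F_inj: "inj_on (F x) V" if x: "x \<in> carrier G" for x
  proof (rule inj_onI)
    fix u v assume uv: "u \<in> V" "v \<in> V" "F x u = F x v"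
    obtain i k j l where ik: "u = (i, k)" "v = (j, l)" by (cases u, cases v)
    have I: "i \<in> I" "j \<in> I" using uv ik by (auto simp: pverts_blowup)
    have "\<pi> x i = \<pi> x j" using uv by (simp add: ik F_app)
    then have "i = j" using inj\<pi>[OF x I(1)] I by (auto simp: inj_on_def)
    moreover have "k = l"
      using uv permutes_inj[OF \<nu>[OF x \<pi>I[OF x I(1)]]] \<open>i = j\<close>
      by (auto simp: ik F_app inj_def)
    ultimately show "u = v" by (simp add: ik)
  qed
  have fin: "finite V" using finite_I by (simp add: pverts_blowup)
  have F: "F x \<in> carrier (graph_Aut B)" if x: "x \<in> carrier G" for x
  proof -
    have "F x ` V = V"
      using F_V[OF x] F_inj[OF x] fin by (intro endo_inj_surj) auto
    then have bij: "bij_betw (F x) V V" using F_inj[OF x] by (simp add: bij_betw_def)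
    have arc: "(u, v) \<in> parcs B \<longleftrightarrow> (F x u, F x v) \<in> parcs B" if uv: "u \<in> V" "v \<in> V" for u v
    proof -
      have "fst (F x u) = \<pi> x (fst u)" "fst (F x v) = \<pi> x (fst v)" "fst u \<in> I" "fst v \<in> I"
        using uv F_app[of "fst u" "snd u" x] F_app[of "fst v" "snd v" x]
        by simp_all (auto simp: pverts_blowup)
      then show ?thesis
        using uv F_V[OF x] inj_on_eq_iff[OF F_inj[OF x]] A\<pi>[OF x]
        by (simp add: parcs_blowup)
    qed
    show ?thesis unfolding graph_Aut_carrier
      using bij arc by (auto simp: F_def)
  qed
  have "F \<in> iso G (graph_Aut B)"
  proof (rule isoI)
    show "F \<in> hom G (graph_Aut B)"
    proof (rule homI)
      fix x y assume xy: "x \<in> carrier G" "y \<in> carrier G"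
      have "F (x \<otimes>\<^bsub>G\<^esub> y) = compose V (F x) (F y)"
      proof (rule ext)
        fix u
        show "F (x \<otimes>\<^bsub>G\<^esub> y) u = compose V (F x) (F y) u"
        proof (cases "u \<in> V")
          case True
          obtain i k where ik: "u = (i, k)" by (cases u)
          have i: "i \<in> I" using True ik by (auto simp: pverts_blowup)
          have "(\<pi> y i, \<nu> y (\<pi> y i) k) \<in> V"
            using F_V[OF xy(2) True] True by (simp add: ik F_app)
          then show ?thesis
            \<comment> \<open>The rule is used at \<open>i\<close> for the indices and at
              \<open>\<pi> y i\<close> for the labels, since \<open>y\<close> applies its label
              permutation over the target index.\<close>
            using True mult[OF xy i] mult[OF xy \<pi>I[OF xy(2) i]]
            by (simp add: ik F_app compose_def)
        qed (simp add: F_def compose_def)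
      qed
      then show "F (x \<otimes>\<^bsub>G\<^esub> y) = F x \<otimes>\<^bsub>graph_Aut B\<^esub> F y"
        using xy F by (simp add: graph_Aut_mult)
    qed (rule F)
    show "bij_betw F (carrier G) (carrier (graph_Aut B))"
      unfolding bij_betw_def
    proof
      show "inj_on F (carrier G)"
      proof (rule inj_onI)
        fix x y assume xy: "x \<in> carrier G" "y \<in> carrier G" "F x = F y"
        have eq: "\<pi> x i = \<pi> y i \<and> \<nu> x (\<pi> x i) k = \<nu> y (\<pi> x i) k"
          if "i \<in> I" "k \<in> {1..m i}" for i k
          using fun_cong[OF xy(3), of "(i, k)"] that by (auto simp: F_app pverts_blowup)
        \<comment> \<open>Fibres are nonempty, so the vertex \<open>(i, 1)\<close> already reveals
          the index map.\<close>
        have eq\<pi>: "\<pi> x i = \<pi> y i" if "i \<in> I" for i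
          using eq[of i 1] two_le[OF that] that by auto
        have eq\<nu>: "\<nu> x j = \<nu> y j" if j: "j \<in> I" for j
        proof
          fix k
          \<comment> \<open>The equation \<open>eq\<close> controls \<open>\<nu>\<close> only at
            indices \<open>\<pi> x i\<close>; surjectivity of \<open>\<pi> x\<close> reaches every
            \<open>j\<close>.\<close>
          obtain i where i: "i \<in> I" "j = \<pi> x i" using surj\<pi>[OF xy(1) j] j by auto
          show "\<nu> x j k = \<nu> y j k"
          proof (cases "k \<in> {1..m j}")
            case True
            then have "k \<in> {1..m i}" using m\<pi>[OF xy(1) i(1)] i(2) by simp
            with eq[OF i(1)] show ?thesis unfolding i(2) by blast
          next
            case False
            then show ?thesis
              using \<nu>[OF xy(1) j] \<nu>[OF xy(2) j] by (simp add: permutes_not_in)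
          qed
        qed
        show "x = y" using inj[OF xy(1,2)] eq\<pi> eq\<nu> by blast
      qed
      show "F ` carrier G = carrier (graph_Aut B)"
      proof
        show "F ` carrier G \<subseteq> carrier (graph_Aut B)" using F by blast
        show "carrier (graph_Aut B) \<subseteq> F ` carrier G"
        proof
          fix f assume f: "f \<in> carrier (graph_Aut B)"
          obtain h \<sigma> where h: "h \<in> weighted_auts I m A"
            and \<sigma>: "\<And>i. i \<in> I \<Longrightarrow> \<sigma> i permutes {1..m i}"
            and f_app: "\<And>i k. (i, k) \<in> V \<Longrightarrow> f (i, k) = (h i, \<sigma> (h i) k)"
            using aut_cases[OF f] by blast
          obtain x where x: "x \<in> carrier G" "\<forall>i\<in>I. \<pi> x i = h i \<and> \<nu> x i = \<sigma> i"
            using surj[OF h \<sigma>] by blast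
          have "f = F x"
          proof (rule extensionalityI[of _ V])
            show "f \<in> extensional V" using f by (simp add: graph_Aut_carrier)
            show "F x \<in> extensional V" by (simp add: F_def)
            fix u assume u: "u \<in> V"
            obtain i k where ik: "u = (i, k)" by (cases u)
            then have i: "i \<in> I" using u by (auto simp: pverts_blowup)
            show "f u = F x u"
              using u i x(2) \<pi>I[OF x(1) i] by (simp add: ik f_app F_app)
          qed
          with x show "f \<in> F ` carrier G" by blast
        qed
      qed
    qed
  qed
  then have "G \<cong> graph_Aut B" by (rule is_isoI)
  then show ?thesis by (rule group.iso_sym[OF \<open>group G\<close>])
qed

end

subsection \<open>Roots of unity in the ring of integers\<close>

unbundle no Formal_Power_Series.fps_syntax

section \<open>Field operations in \<open>imag_quadratic_field\<close>\<close>

lemma a_inv_ring_of_type_algebra: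
  "\<ominus>\<^bsub>ring_of_type_algebra\<^esub> x = - (x :: 'a :: field)"
proof -
  interpret F: field "ring_of_type_algebra :: 'a ring" ..
  show ?thesis
    by (rule F.minus_equality) (simp_all add: ring_of_type_algebra_def)
qed

lemma m_inv_ring_of_type_algebra:
  assumes "x \<noteq> 0"
  shows "inv\<^bsub>ring_of_type_algebra\<^esub> x = inverse (x :: 'a :: field)"
proof -
  interpret F: field "ring_of_type_algebra :: 'a ring" ..
  show ?thesis
    by (rule F.comm_inv_char) (use assms in \<open>simp_all add: ring_of_type_algebra_def\<close>)
qed

lemma imag_quadratic_field_csqrt: "csqrt (- of_nat d) \<in> imag_quadratic_field d"
  unfolding imag_quadratic_field_def by (rule generate_field.incl) simp

text \<open>These are the generating rules of \<open>generate_field\<close>, with the operations of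
  \<open>ring_of_type_algebra\<close> replaced by those of the complex numbers.\<close>

lemma imag_quadratic_field_closed:
  shows imag_quadratic_field_1: "1 \<in> imag_quadratic_field d"
    and imag_quadratic_field_uminus:
      "x \<in> imag_quadratic_field d \<Longrightarrow> - x \<in> imag_quadratic_field d"
    and imag_quadratic_field_inverse:
      "x \<in> imag_quadratic_field d \<Longrightarrow> x \<noteq> 0 \<Longrightarrow> inverse x \<in> imag_quadratic_field d"
    and imag_quadratic_field_add:
      "x \<in> imag_quadratic_field d \<Longrightarrow> y \<in> imag_quadratic_field d \<Longrightarrow>
        x + y \<in> imag_quadratic_field d"
    and imag_quadratic_field_mult:
      "x \<in> imag_quadratic_field d \<Longrightarrow> y \<in> imag_quadratic_field d \<Longrightarrow>
        x * y \<in> imag_quadratic_field d"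
proof -
  let ?R = "ring_of_type_algebra :: complex ring" and ?H = "{csqrt (- of_nat d)}"
  note gen = generate_field.one[of ?R ?H] generate_field.a_inv[of x ?R ?H]
    generate_field.m_inv[of x ?R ?H] generate_field.eng_add[of x ?R ?H y]
    generate_field.eng_mult[of x ?R ?H y]
  have ops: "\<one>\<^bsub>?R\<^esub> = 1" "\<zero>\<^bsub>?R\<^esub> = 0" "x \<oplus>\<^bsub>?R\<^esub> y = x + y" "x \<otimes>\<^bsub>?R\<^esub> y = x * y"
    by (simp_all add: ring_of_type_algebra_def)
  show "1 \<in> imag_quadratic_field d"
    and "x \<in> imag_quadratic_field d \<Longrightarrow> - x \<in> imag_quadratic_field d"
    and "x \<in> imag_quadratic_field d \<Longrightarrow> x \<noteq> 0 \<Longrightarrow> inverse x \<in> imag_quadratic_field d"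
    and "x \<in> imag_quadratic_field d \<Longrightarrow> y \<in> imag_quadratic_field d \<Longrightarrow>
        x + y \<in> imag_quadratic_field d"
    and "x \<in> imag_quadratic_field d \<Longrightarrow> y \<in> imag_quadratic_field d \<Longrightarrow>
        x * y \<in> imag_quadratic_field d"
    using gen unfolding imag_quadratic_field_def ops a_inv_ring_of_type_algebra
    by (simp_all add: m_inv_ring_of_type_algebra)
qed

lemma imag_quadratic_field_0: "0 \<in> imag_quadratic_field d"
  using imag_quadratic_field_add[OF imag_quadratic_field_1
      imag_quadratic_field_uminus[OF imag_quadratic_field_1]] by simp

lemma imag_quadratic_field_of_nat: "of_nat k \<in> imag_quadratic_field d"
  by (induction k) (auto intro: imag_quadratic_field_0 imag_quadratic_field_1
      imag_quadratic_field_add)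

lemma imag_quadratic_field_of_int: "of_int k \<in> imag_quadratic_field d"
  by (cases k rule: int_cases2)
    (auto intro: imag_quadratic_field_of_nat imag_quadratic_field_uminus)

lemma imag_quadratic_field_power:
  "x \<in> imag_quadratic_field d \<Longrightarrow> x ^ k \<in> imag_quadratic_field d"
  by (induction k) (auto intro: imag_quadratic_field_1 imag_quadratic_field_mult)

section \<open>Integrality of radicals and the units for \<open>d = 1\<close> and
  \<open>d = 3\<close>\<close>

lemma algebraic_int_power_in_Ints:
  fixes x :: "'a :: field_char_0"
  assumes "x ^ k \<in> \<int>" "k > 0"
  shows "algebraic_int x"
proof (rule algebraic_int_root)
  show "algebraic_int (x ^ k)" using assms(1) by (rule int_imp_algebraic_int)
  show "poly (Polynomial.monom 1 k) x = x ^ k" by (simp add: poly_monom)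
qed (use assms(2) in \<open>auto simp: degree_monom_eq\<close>)

text \<open>The \<open>r\<close>-th power is \<open>l ^ r * (t ^ r) ^ k\<close>, an integer. For
  \<open>k\<close> from 0 to 3 this covers every entry of an integer multiple of the matrix with
  parameter \<open>t\<close>.\<close>

lemma ring_of_integers_radical:
  assumes "t \<in> imag_quadratic_field d" "t ^ r \<in> \<int>" "r > 0"
  shows "of_int l * t ^ k \<in> ring_of_integers (imag_quadratic_field d)"
proof -
  have "(of_int l * t ^ k) ^ r = of_int (l ^ r) * (t ^ r) ^ k"
    by (simp add: power_mult_distrib mult.commute flip: power_mult)
  also have "\<dots> \<in> \<int>" using assms(2) by (intro Ints_mult Ints_power[of "t ^ r"]) auto
  finally have "algebraic_int (of_int l * t ^ k)"
    using assms(3) by (rule algebraic_int_power_in_Ints)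
  then show ?thesis
    using assms(1) by (simp add: ring_of_integers_def imag_quadratic_field_mult
        imag_quadratic_field_of_int imag_quadratic_field_power)
qed

lemma ii_in_imag_quadratic_field: "\<i> \<in> imag_quadratic_field 1"
  using imag_quadratic_field_csqrt[of 1] by simp

text \<open>This is the familiar (-1 + sqrt(-3)) / 2, written with \<open>inverse 2\<close> to fit
  the closure rules of the field.\<close>

lemma primitive_cube_root_altdef:
  "primitive_cube_root = (csqrt (- of_nat 3) - 1) * inverse 2"
proof -
  have "cos (2 * pi / 3) = - 1 / 2" "sin (2 * pi / 3) = sqrt 3 / 2"
    using cos_120 sin_120 by simp_all
  then show ?thesis
    by (simp add: primitive_cube_root_def complex_eq_iff)
qed

lemma primitive_cube_root_in_imag_quadratic_field:
  "primitive_cube_root \<in> imag_quadratic_field 3"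
proof -
  have "csqrt (- of_nat 3) + - 1 \<in> imag_quadratic_field 3"
    by (intro imag_quadratic_field_add imag_quadratic_field_csqrt
        imag_quadratic_field_uminus imag_quadratic_field_1)
  moreover have "inverse 2 \<in> imag_quadratic_field 3"
    using imag_quadratic_field_inverse[OF imag_quadratic_field_of_nat[of 2]] by simp
  ultimately show ?thesis
    unfolding primitive_cube_root_altdef diff_conv_add_uminus
    by (rule imag_quadratic_field_mult)
qed

text \<open>The cube is 1 by De Moivre's formula, and the real part -1/2 excludes the value 1, so
  the order is exactly 3.\<close>

lemma primitive_cube_root_power_eq_1_iff: "primitive_cube_root ^ k = 1 \<longleftrightarrow> 3 dvd k"
proof -
  let ?w = primitive_cube_root
  have cube: "?w ^ 3 = 1"
    unfolding primitive_cube_root_def Complex.DeMoivre by simp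
  have "cos (2 * pi / 3) = - 1 / 2"
    using cos_120 by simp
  then have Re: "Re ?w = - 1 / 2" by (simp add: primitive_cube_root_def)
  then have ne1: "?w \<noteq> 1" by auto
  have ne2: "?w ^ 2 \<noteq> 1"
  proof
    assume "?w ^ 2 = 1"
    then have "?w ^ 3 = ?w" by (simp add: power3_eq_cube power2_eq_square)
    then show False using cube ne1 by simp
  qed
  have "?w ^ k = ?w ^ (3 * (k div 3) + k mod 3)" by simp
  also have "\<dots> = ?w ^ (k mod 3)"
    unfolding power_add power_mult cube by simp
  finally have red: "?w ^ k = ?w ^ (k mod 3)" .
  have "k mod 3 < 3" by simp
  then consider "k mod 3 = 0" | "k mod 3 = 1" | "k mod 3 = 2" by linarith
  then show ?thesis
    by cases (use ne1 ne2 in \<open>simp_all add: red dvd_eq_mod_eq_0\<close>)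
qed

subsection \<open>Products of the matrices\<close>

definition tc :: "complex \<Rightarrow> complex^2^2" where
  "tc t = vector [vector [1, t], vector [t^2, t^3]]"

lemma tc_nth:
  "tc t $ 1 $ 1 = 1" "tc t $ 1 $ 2 = t" "tc t $ 2 $ 1 = t^2" "tc t $ 2 $ 2 = t^3"
  by (simp_all add: tc_def)

text \<open>The product is \<open>a * b * (1 + s * t^2)\<close> times the matrix with rows
  \<open>(1, t)\<close> and \<open>(s^2, s^2 * t)\<close>, so its upper left entry alone decides
  whether it vanishes.\<close>

lemma scaled_tc_mult_eq_0_iff:
  assumes "a \<noteq> 0" "b \<noteq> 0"
  shows "(a *\<^sub>R tc s) ** (b *\<^sub>R tc t) = 0 \<longleftrightarrow> s * t^2 = -1"
proof -
  have "((a *\<^sub>R tc s) ** (b *\<^sub>R tc t)) $ 1 $ 1 = (a * b) *\<^sub>R (1 + s * t^2)"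
    by (simp add: matrix_matrix_mult_def sum_2 tc_nth algebra_simps flip: scaleR_add_right)
  moreover have "((a *\<^sub>R tc s) ** (b *\<^sub>R tc t)) $ 1 $ 2 = (a * b) *\<^sub>R (t * (1 + s * t^2))"
    by (simp add: matrix_matrix_mult_def sum_2 tc_nth algebra_simps power3_eq_cube
        power2_eq_square flip: scaleR_add_right)
  moreover have "((a *\<^sub>R tc s) ** (b *\<^sub>R tc t)) $ 2 $ 1 = (a * b) *\<^sub>R (s^2 * (1 + s * t^2))"
    by (simp add: matrix_matrix_mult_def sum_2 tc_nth algebra_simps power3_eq_cube
        power2_eq_square flip: scaleR_add_right)
  moreover have "((a *\<^sub>R tc s) ** (b *\<^sub>R tc t)) $ 2 $ 2 = (a * b) *\<^sub>R (s^2 * t * (1 + s * t^2))"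
    by (simp add: matrix_matrix_mult_def sum_2 tc_nth algebra_simps power3_eq_cube
        power2_eq_square flip: scaleR_add_right)
  ultimately have "(a *\<^sub>R tc s) ** (b *\<^sub>R tc t) = 0 \<longleftrightarrow> 1 + s * t^2 = 0"
    using assms by (auto simp: vec_eq_iff forall_2)
  also have "\<dots> \<longleftrightarrow> s * t^2 = -1" by (simp add: eq_neg_iff_add_eq_0 add.commute)
  finally show ?thesis .
qed

section \<open>Sizes, disjointness and products of the vertex classes\<close>

definition scalars :: "nat \<Rightarrow> int set" where
  "scalars N = {l. 1 \<le> \<bar>l\<bar> \<and> \<bar>l\<bar> \<le> int N}"

lemma scalars_nonzero: "l \<in> scalars N \<Longrightarrow> l \<noteq> 0"
  by (auto simp: scalars_def)

lemma scalars_finite: "finite (scalars N)" and card_scalars: "card (scalars N) = 2 * N"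
proof -
  have eq: "scalars N = {1..int N} \<union> {- int N..-1}" by (auto simp: scalars_def)
  show "finite (scalars N)" unfolding eq by simp
  show "card (scalars N) = 2 * N" unfolding eq by (subst card_Un_disjoint) auto
qed

lemma S_tc1_altdef: "S_tc1 t N = (\<lambda>l. real_of_int l *\<^sub>R tc t) ` scalars N"
  by (auto simp: S_tc1_def tc_def scalars_def)

text \<open>The upper left entry recovers the scalar, and its right neighbour then recovers the
  parameter. Sizes and disjointness of the classes follow.\<close>

lemma scaled_tc_eq_iff:
  assumes "l \<noteq> 0"
  shows "real_of_int l *\<^sub>R tc s = real_of_int k *\<^sub>R tc t \<longleftrightarrow> l = k \<and> s = t"
proof
  assume eq: "real_of_int l *\<^sub>R tc s = real_of_int k *\<^sub>R tc t"
  have "l = k" using arg_cong[OF eq, of "\<lambda>A :: complex^2^2. A $ 1 $ 1"]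
    by (simp add: tc_nth)
  moreover have "s = t"
    using arg_cong[OF eq, of "\<lambda>A :: complex^2^2. A $ 1 $ 2"] \<open>l = k\<close> assms by (simp add: tc_nth)
  ultimately show "l = k \<and> s = t" ..
qed simp

lemma finite_S_tc1: "finite (S_tc1 t N)"
  by (simp add: S_tc1_altdef scalars_finite)

lemma card_S_tc1: "card (S_tc1 t N) = 2 * N"
  unfolding S_tc1_altdef
  by (subst card_image) (simp_all add: card_scalars inj_on_def scaled_tc_eq_iff scalars_nonzero
      del: scaleR_cancel_right)

lemma S_tc1_disjoint: "s \<noteq> t \<Longrightarrow> S_tc1 s N \<inter> S_tc1 t N = {}"
  by (auto simp: S_tc1_altdef scaled_tc_eq_iff scalars_nonzero)

lemma S_tc1_mult_eq_0_iff:
  assumes "u \<in> S_tc1 s N" "v \<in> S_tc1 t N"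
  shows "u ** v = 0 \<longleftrightarrow> s * t^2 = -1"
  using assms by (auto simp: S_tc1_altdef scaled_tc_mult_eq_0_iff scalars_nonzero)

lemma S_tc2_altdef:
  "S_tc2 N = (\<lambda>l. vector [vector [0, 0], vector [0, of_int l]]) ` scalars N"
  by (auto simp: S_tc2_def scalars_def)

lemma S_tc2_nth:
  fixes v :: "complex^2^2"
  assumes "v \<in> S_tc2 N"
  obtains l where "l \<noteq> 0" "v $ 1 $ 1 = 0" "v $ 1 $ 2 = 0" "v $ 2 $ 1 = 0" "v $ 2 $ 2 = of_int l"
proof -
  from assms obtain l where l: "l \<in> scalars N"
    and v: "v = vector [vector [0, 0], vector [0, of_int l]]"
    by (auto simp: S_tc2_altdef)
  show thesis by (rule that[OF scalars_nonzero[OF l]]) (simp_all add: v)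
qed

lemma finite_S_tc2: "finite (S_tc2 N)"
  by (simp add: S_tc2_altdef scalars_finite)

lemma card_S_tc2: "card (S_tc2 N) = 2 * N"
proof -
  have "inj_on (\<lambda>l. vector [vector [0, 0], vector [0, of_int l]] :: complex^2^2) (scalars N)"
    by (auto simp: inj_on_def vec_eq_iff forall_2)
  then show ?thesis by (simp add: S_tc2_altdef card_image card_scalars)
qed

lemma S_tc1_nth:
  fixes v :: "complex^2^2"
  assumes "v \<in> S_tc1 t N"
  obtains l where "l \<noteq> 0" "v $ 1 $ 1 = of_int l" "v $ 1 $ 2 = of_int l * t"
    "v $ 2 $ 1 = of_int l * t^2" "v $ 2 $ 2 = of_int l * t^3"
proof -
  from assms obtain l where l: "l \<in> scalars N" and v: "v = real_of_int l *\<^sub>R tc t"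
    by (auto simp: S_tc1_altdef)
  show thesis
    by (rule that[OF scalars_nonzero[OF l]])
      (simp_all add: v tc_nth scaleR_conv_of_real[where 'a = complex])
qed

lemma S_tc1_S_tc2_disjoint: "S_tc1 t N \<inter> S_tc2 N = {}"
proof -
  have False if "v \<in> S_tc1 t N" "v \<in> S_tc2 N" for v
    using that by (elim S_tc1_nth S_tc2_nth) simp
  then show ?thesis by blast
qed

text \<open>The two classes consist of multiples of the two orthogonal diagonal idempotents.\<close>

lemma S_tc1_0_mult_S_tc2:
  assumes "u \<in> S_tc1 0 N" "v \<in> S_tc2 N"
  shows "u ** v = 0" "v ** u = 0"
  using assms
  by (elim S_tc1_nth S_tc2_nth; simp add: vec_eq_iff forall_2 matrix_matrix_mult_def sum_2)+

lemma S_tc2_mult_S_tc2: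
  assumes "u \<in> S_tc2 N" "v \<in> S_tc2 N"
  shows "u ** v \<noteq> 0"
  using assms
  by (elim S_tc2_nth) (simp add: vec_eq_iff forall_2 matrix_matrix_mult_def sum_2)

section \<open>Zero-divisor vertices and adjacency in induced subgraphs\<close>

abbreviation quadratic_M2 :: "nat \<Rightarrow> (complex^2^2) set" where
  "quadratic_M2 d \<equiv> mat2_over (ring_of_integers (imag_quadratic_field d))"

lemma ring_of_integers_of_int: "of_int l \<in> ring_of_integers (imag_quadratic_field d)"
  using ring_of_integers_radical[of 1 d 1 l 0] by (simp add: imag_quadratic_field_1)

text \<open>An induced subgraph keeps only those matrices that are vertices of the whole graph; the
  inclusion shows that none is lost.\<close>

lemma S_tc1_zero_divisors:
  assumes t: "t \<in> imag_quadratic_field d" "t ^ r \<in> \<int>" "r > 0"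
  shows "S_tc1 t N \<subseteq> zero_divisor_vertices (quadratic_M2 d)"
proof
  fix v :: "complex^2^2" assume "v \<in> S_tc1 t N"
  then obtain l where v: "l \<noteq> 0" "v $ 1 $ 1 = of_int l" "v $ 1 $ 2 = of_int l * t"
    "v $ 2 $ 1 = of_int l * t^2" "v $ 2 $ 2 = of_int l * t^3"
    by (rule S_tc1_nth)
  \<comment> \<open>Both rows of \<open>v\<close> are multiples of \<open>(1, t)\<close>, which
    kills the column \<open>(-t, 1)\<close>.\<close>
  let ?B = "vector [vector [-t, 0], vector [1, 0]] :: complex^2^2"
  note ring = ring_of_integers_radical[OF t, of l 0] ring_of_integers_radical[OF t, of l 1]
    ring_of_integers_radical[OF t, of l 2] ring_of_integers_radical[OF t, of l 3]
    ring_of_integers_radical[OF t, of "-1" 1] ring_of_integers_of_int[of 0 d]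
    ring_of_integers_of_int[of 1 d]
  have "v \<in> quadratic_M2 d" using ring v by (simp add: mat2_over_def forall_2)
  moreover have "?B \<in> quadratic_M2 d" using ring by (simp add: mat2_over_def forall_2)
  moreover have "?B \<noteq> 0" by (simp add: vec_eq_iff forall_2)
  moreover have "v ** ?B = 0"
    using v by (simp add: vec_eq_iff forall_2 matrix_matrix_mult_def sum_2
        power2_eq_square power3_eq_cube)
  moreover have "v \<noteq> 0" using v by (auto simp: vec_eq_iff forall_2)
  ultimately show "v \<in> zero_divisor_vertices (quadratic_M2 d)"
    by (auto simp: zero_divisor_vertices_def left_zero_divisor_def)
qed

lemma S_tc2_zero_divisors: "S_tc2 N \<subseteq> zero_divisor_vertices (quadratic_M2 d)"
proof
  fix v :: "complex^2^2" assume "v \<in> S_tc2 N"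
  then obtain l where v: "l \<noteq> 0" "v $ 1 $ 1 = 0" "v $ 1 $ 2 = 0" "v $ 2 $ 1 = 0"
    "v $ 2 $ 2 = of_int l"
    by (rule S_tc2_nth)
  \<comment> \<open>Only the second column of \<open>v\<close> is nonzero, so it annihilates any
    matrix supported in the first row.\<close>
  let ?B = "vector [vector [1, 0], vector [0, 0]] :: complex^2^2"
  note ring = ring_of_integers_of_int[of 0 d] ring_of_integers_of_int[of 1 d]
    ring_of_integers_of_int[of l d]
  have "v \<in> quadratic_M2 d" using ring v by (simp add: mat2_over_def forall_2)
  moreover have "?B \<in> quadratic_M2 d" using ring by (simp add: mat2_over_def forall_2)
  moreover have "?B \<noteq> 0" by (simp add: vec_eq_iff forall_2)
  moreover have "v ** ?B = 0"
    using v by (simp add: vec_eq_iff forall_2 matrix_matrix_mult_def sum_2)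
  moreover have "v \<noteq> 0" using v by (auto simp: vec_eq_iff forall_2)
  ultimately show "v \<in> zero_divisor_vertices (quadratic_M2 d)"
    by (auto simp: zero_divisor_vertices_def left_zero_divisor_def)
qed

lemma parcs_mk_symmetric_with_proj:
  "(u, v) \<in> parcs (mk_symmetric (with_proj G)) \<longleftrightarrow> (u, v) \<in> parcs G \<or> (v, u) \<in> parcs G"
  by (auto simp: parcs_mk_symmetric intro: bexI[of _ "(v, u)"])

lemma undirected_induced_Gamma_M2:
  assumes "S \<subseteq> zero_divisor_vertices (quadratic_M2 d)"
  shows "pverts (mk_symmetric (with_proj (induced_on (Gamma_M2 d) S))) = S"
    and "(u, v) \<in> parcs (mk_symmetric (with_proj (induced_on (Gamma_M2 d) S))) \<longleftrightarrow>
      u \<in> S \<and> v \<in> S \<and> u \<noteq> v \<and> (u ** v = 0 \<or> v ** u = 0)"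
  using assms by (auto simp: parcs_mk_symmetric_with_proj induced_on_def Gamma_M2_def zero_divisor_graph_def)

subsection \<open>The automorphism groups\<close>

lemma UN_U_set_zero_divisors:
  "(\<Union>j\<in>U_set d. S_tc1 j N) \<subseteq> zero_divisor_vertices (quadratic_M2 d)"
proof -
  have "\<exists>r>0. t \<in> imag_quadratic_field d \<and> t ^ r \<in> \<int>" if t: "t \<in> U_set d" for t
  proof -
    have K: "t \<in> imag_quadratic_field d"
      using t imag_quadratic_field_1[of d] ii_in_imag_quadratic_field
        primitive_cube_root_in_imag_quadratic_field
      by (auto simp: U_set_def imag_quadratic_field_uminus imag_quadratic_field_power
          split: if_splits)
    \<comment> \<open>The exponent 12 is a common multiple of 2, 4 and 6, the orders of the possible
      groups \<open>U_set d\<close>. The exponent 24 arises from the square of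
      \<open>primitive_cube_root\<close>.\<close>
    have w: "primitive_cube_root ^ 12 = 1" "primitive_cube_root ^ 24 = 1"
      by (simp_all add: primitive_cube_root_power_eq_1_iff)
    have i: "\<i> ^ 12 = 1" by (simp add: power_eq_if)
    have "t ^ 12 = 1"
      using t w i by (auto simp: U_set_def power_minus_even simp flip: power_mult split: if_splits)
    then have "t ^ 12 \<in> \<int>" by simp
    with K show ?thesis by (intro exI[of _ 12]) simp
  qed
  then show ?thesis using S_tc1_zero_divisors by blast
qed

lemma pverts_Gamma2_un: "pverts (Gamma2_un d N) = (\<Union>j\<in>U_set d. S_tc1 j N)"
  unfolding Gamma2_un_def Gamma2_def
  by (rule undirected_induced_Gamma_M2[OF UN_U_set_zero_divisors])

lemma parcs_Gamma2_un:
  assumes "s \<in> U_set d" "t \<in> U_set d" "u \<in> S_tc1 s N" "v \<in> S_tc1 t N"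
  shows "(u, v) \<in> parcs (Gamma2_un d N) \<longleftrightarrow> u \<noteq> v \<and> (s * t^2 = -1 \<or> t * s^2 = -1)"
  unfolding Gamma2_un_def Gamma2_def undirected_induced_Gamma_M2[OF UN_U_set_zero_divisors]
  using assms by (auto simp: S_tc1_mult_eq_0_iff)

lemma S_tc1_0_S_tc2_zero_divisors:
  "S_tc1 0 N \<union> S_tc2 N \<subseteq> zero_divisor_vertices (quadratic_M2 d)"
  using S_tc1_zero_divisors[of 0 d 1 N] S_tc2_zero_divisors[of N d]
  by (simp add: imag_quadratic_field_0)

text \<open>The graph is complete bipartite with both sides of size \<open>2*n\<close>; the
  nontrivial element of \<open>C2\<close> exchanges the sides.\<close>

lemma graph_Aut_Gamma1:
  assumes "n \<ge> 1"
  shows "graph_Aut (Gamma1 d n) \<cong>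
    semidirect (sym_group (2*n) \<times>\<times> sym_group (2*n)) swap_action C2"
    (is "_ \<cong> ?G")
proof -
  define V where "V = (\<lambda>b. if b then S_tc2 n else S_tc1 0 n)"
  let ?m = "\<lambda>_ :: bool. 2 * n"
  let ?A = "\<lambda>i j :: bool. i \<noteq> j"
  interpret reduced_blowup UNIV ?m ?A
    by unfold_locales (use assms in auto)
  have "graph_Aut (Gamma1 d n) \<cong> graph_Aut B"
  proof (rule graph_Aut_iso_blowup[where V = V])
    show "disjoint_family_on V UNIV"
      using S_tc1_S_tc2_disjoint[of 0 n] by (auto simp: disjoint_family_on_def V_def)
    show "pverts (Gamma1 d n) = (\<Union>i. V i)"
      unfolding Gamma1_def undirected_induced_Gamma_M2[OF S_tc1_0_S_tc2_zero_divisors]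
      by (auto simp: V_def split: if_splits)
    fix i j u v assume "u \<in> V i" "v \<in> V j"
    then show "(u, v) \<in> parcs (Gamma1 d n) \<longleftrightarrow> u \<noteq> v \<and> i \<noteq> j"
      unfolding Gamma1_def undirected_induced_Gamma_M2[OF S_tc1_0_S_tc2_zero_divisors]
      using S_tc1_S_tc2_disjoint[of 0 n]
      by (auto simp: V_def S_tc1_mult_eq_0_iff S_tc1_0_mult_S_tc2 S_tc2_mult_S_tc2
          split: if_splits)
  qed (auto simp: V_def finite_S_tc1 finite_S_tc2 card_S_tc1 card_S_tc2)
  also have "graph_Aut B \<cong> ?G"
  proof (rule Aut_iso)
    show grp: "group ?G"
      by (intro semidirect_group swap_action_hom DirProd_group sym_group_is_group
          group_integer_mod_group)
    \<comment> \<open>The exchange acts first; then \<open>x\<close> permutes the fibre over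
      \<open>False\<close> and \<open>y\<close> the one over \<open>True\<close>.\<close>
    let ?\<pi> = "\<lambda>((x, y), k :: int) i. if k = 0 then i else \<not> i"
    let ?\<nu> = "\<lambda>((x, y), k :: int) i. if i then y else x :: nat \<Rightarrow> nat"
    have G: "carrier ?G = ({p. p permutes {1..2*n}} \<times> {p. p permutes {1..2*n}}) \<times> {0, 1}"
      by (auto simp: semidirect_def sym_group_def carrier_integer_mod_group)
    show "?\<pi> x \<in> weighted_auts UNIV ?m ?A" if "x \<in> carrier ?G" for x
    proof -
      have "bij Not" by (rule involuntory_imp_bij) simp
      then show ?thesis
        by (cases "snd x = 0")
          (auto simp: weighted_auts_def bij_id[unfolded id_def] split: prod.splits)
    qed
    show "?\<nu> x i permutes {1..2*n}" if "x \<in> carrier ?G" for x i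
      using that unfolding G by auto
    show "?\<pi> (x \<otimes>\<^bsub>?G\<^esub> y) i = ?\<pi> x (?\<pi> y i) \<and> ?\<nu> (x \<otimes>\<^bsub>?G\<^esub> y) (?\<pi> x i) = ?\<nu> x (?\<pi> x i) \<circ> ?\<nu> y i"
      if "x \<in> carrier ?G" "y \<in> carrier ?G" for x y i
      using that unfolding G
      by (auto simp: semidirect_def sym_group_def swap_action_def)
    show "x = y" if "x \<in> carrier ?G" "y \<in> carrier ?G"
      "\<And>i. i \<in> UNIV \<Longrightarrow> ?\<pi> x i = ?\<pi> y i \<and> ?\<nu> x i = ?\<nu> y i" for x y
      using that(1,2) that(3)[of True] that(3)[of False] unfolding G
      by (auto split: if_splits)
    show "\<exists>x\<in>carrier ?G. \<forall>i\<in>UNIV. ?\<pi> x i = h i \<and> ?\<nu> x i = \<sigma> i"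
      if h: "h \<in> weighted_auts UNIV ?m ?A" and \<sigma>: "\<And>i. i \<in> UNIV \<Longrightarrow> \<sigma> i permutes {1..2*n}"
      for h \<sigma>
    proof
      \<comment> \<open>An injective \<open>h\<close> on two indices is the exchange exactly when
        \<open>h False\<close> holds.\<close>
      let ?x = "((\<sigma> False, \<sigma> True), if h False then 1 else 0 :: int)"
      show "?x \<in> carrier ?G" using \<sigma> unfolding G by auto
      have "h True \<noteq> h False" using h by (auto simp: weighted_auts_def)
      then show "\<forall>i\<in>UNIV. ?\<pi> ?x i = h i \<and> ?\<nu> ?x i = \<sigma> i"
        by (auto simp: all_bool_eq)
    qed
  qed
  finally show ?thesis .
qed

text \<open>For signs, \<open>s * t^2 = s\<close>. Hence the class of \<open>-1\<close> is a clique
  joined to everything and the class of \<open>1\<close> is independent, so the two cannot be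
  exchanged.\<close>

lemma graph_Aut_Gamma2_un_generic:
  assumes "n \<ge> 1" "d \<noteq> 1" "d \<noteq> 3"
  shows "graph_Aut (Gamma2_un d n) \<cong> sym_group (2*n) \<times>\<times> sym_group (2*n)"
    (is "_ \<cong> ?G")
proof -
  have U: "U_set d = {1, -1}" using assms by (simp add: U_set_def)
  define V where "V = (\<lambda>b. S_tc1 (if b then -1 else 1) n)"
  let ?m = "\<lambda>_ :: bool. 2 * n"
  let ?A = "\<lambda>i j :: bool. i \<or> j"
  interpret reduced_blowup UNIV ?m ?A
    by unfold_locales (use assms in auto)
  have "graph_Aut (Gamma2_un d n) \<cong> graph_Aut B"
  proof (rule graph_Aut_iso_blowup[where V = V])
    show "disjoint_family_on V UNIV"
      using S_tc1_disjoint[of 1 "-1" n] by (auto simp: disjoint_family_on_def V_def)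
    show "pverts (Gamma2_un d n) = (\<Union>i. V i)"
      by (auto simp: V_def pverts_Gamma2_un U UNIV_bool)
    fix i j u v assume "u \<in> V i" "v \<in> V j"
    then show "(u, v) \<in> parcs (Gamma2_un d n) \<longleftrightarrow> u \<noteq> v \<and> (i \<or> j)"
      using parcs_Gamma2_un[of "if i then -1 else 1" d "if j then -1 else 1" u n v]
      by (cases i; cases j) (simp_all add: V_def U)
  qed (auto simp: V_def finite_S_tc1 card_S_tc1)
  also have "graph_Aut B \<cong> ?G"
  proof (rule Aut_iso)
    show "group ?G" by (intro DirProd_group sym_group_is_group)
    let ?\<pi> = "\<lambda>(x, y) i. i"
    let ?\<nu> = "\<lambda>(x, y) i. if i then y else x :: nat \<Rightarrow> nat"
    show "\<exists>x\<in>carrier ?G. \<forall>i\<in>UNIV. ?\<pi> x i = h i \<and> ?\<nu> x i = \<sigma> i"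
      if h: "h \<in> weighted_auts UNIV ?m ?A" and \<sigma>: "\<And>i. i \<in> UNIV \<Longrightarrow> \<sigma> i permutes {1..2*n}"
      for h \<sigma>
    proof
      show "(\<sigma> False, \<sigma> True) \<in> carrier ?G" using \<sigma> by (simp add: sym_group_def)
      \<comment> \<open>Only \<open>True\<close> carries a loop, so \<open>h\<close> fixes both
        indices.\<close>
      have "h i = i" for i using h by (auto simp: weighted_auts_def)
      then show "\<forall>i\<in>UNIV. ?\<pi> (\<sigma> False, \<sigma> True) i = h i \<and> ?\<nu> (\<sigma> False, \<sigma> True) i = \<sigma> i"
        by (simp add: all_bool_eq)
    qed
    show "x = y" if "x \<in> carrier ?G" "y \<in> carrier ?G"
      "\<And>i. i \<in> UNIV \<Longrightarrow> ?\<pi> x i = ?\<pi> y i \<and> ?\<nu> x i = ?\<nu> y i" for x y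
      using that(3)[of True] that(3)[of False] by (auto split: prod.splits)
  qed (auto simp: weighted_auts_id sym_group_def)
  finally show ?thesis .
qed

text \<open>Both \<open>\<i>\<close> and \<open>-\<i>\<close> have square -1, and within
  \<open>U_set 1\<close> the equation \<open>s * t^2 = -1\<close> never holds with \<open>s\<close>
  one of them. Their vertices thus have the same neighbours and form one class of size
  \<open>4*n\<close>.\<close>

lemma graph_Aut_Gamma2_un_1:
  assumes "n \<ge> 1"
  shows "graph_Aut (Gamma2_un 1 n) \<cong>
    sym_group (2*n) \<times>\<times> sym_group (2*n) \<times>\<times> sym_group (4*n)"
    (is "_ \<cong> ?G")
proof -
  have U: "U_set 1 = {1, -1, \<i>, -\<i>}" by (simp add: U_set_def)
  define T :: "nat \<Rightarrow> complex set"
    where "T = (\<lambda>i. if i = 0 then {-1} else if i = 1 then {1} else {\<i>, -\<i>})"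
  define V where "V = (\<lambda>i. \<Union>t\<in>T i. S_tc1 t n)"
  let ?I = "{0, 1, 2} :: nat set"
  define m where "m = (\<lambda>i :: nat. if i = 2 then 4 * n else 2 * n)"
  \<comment> \<open>the edges \<open>0-0\<close>, \<open>0-1\<close>, \<open>1-2\<close>\<close>
  define A where "A = (\<lambda>i j :: nat. i + j \<le> 1 \<or> i + j = 3)"
  interpret reduced_blowup ?I m A
  proof
    fix i j assume ij: "i \<in> ?I" "j \<in> ?I" and eq: "\<And>l. l \<in> ?I \<Longrightarrow> A i l \<longleftrightarrow> A j l"
    \<comment> \<open>Column 0 singles out the index 2, and column 2 singles out the index
      1.\<close>
    show "i = j" using ij eq[of 0] eq[of 2] by (auto simp: A_def)
  qed (use assms in \<open>auto simp: m_def\<close>)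
  have TU: "T i \<subseteq> U_set 1" for i unfolding U by (auto simp: T_def)
  have "graph_Aut (Gamma2_un 1 n) \<cong> graph_Aut B"
  proof (rule graph_Aut_iso_blowup[where V = V])
    fix i assume i: "i \<in> ?I"
    show "finite (V i)" by (auto simp: V_def T_def finite_S_tc1)
    have "card (V i) = card (T i) * (2 * n)"
      unfolding V_def
      by (subst card_UN_disjoint) (auto simp: T_def finite_S_tc1 card_S_tc1 S_tc1_disjoint)
    then show "card (V i) = m i" using i by (auto simp: m_def T_def)
  next
    show "disjoint_family_on V ?I"
      unfolding disjoint_family_on_def V_def
    proof (intro ballI impI)
      fix i j assume "i \<in> ?I" "j \<in> ?I" "i \<noteq> j"
      then have "s \<noteq> t" if "s \<in> T i" "t \<in> T j" for s t
        using that by (auto simp: T_def complex_eq_iff split: if_splits)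
      then show "(\<Union>t\<in>T i. S_tc1 t n) \<inter> (\<Union>t\<in>T j. S_tc1 t n) = {}"
        using S_tc1_disjoint by blast
    qed
    show "pverts (Gamma2_un 1 n) = (\<Union>i\<in>?I. V i)"
      unfolding pverts_Gamma2_un U by (auto simp: V_def T_def)
    fix i j u v assume ij: "i \<in> ?I" "j \<in> ?I" and uv: "u \<in> V i" "v \<in> V j"
    from uv obtain s t where st: "s \<in> T i" "t \<in> T j" "u \<in> S_tc1 s n" "v \<in> S_tc1 t n"
      by (auto simp: V_def)
    have "\<i> \<noteq> 1" "\<i> \<noteq> -1" "- \<i> \<noteq> 1" by (simp_all add: complex_eq_iff)
    then have "s * t^2 = -1 \<or> t * s^2 = -1 \<longleftrightarrow> A i j"
      using ij st(1,2) by (auto simp: T_def A_def)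
    then show "(u, v) \<in> parcs (Gamma2_un 1 n) \<longleftrightarrow> u \<noteq> v \<and> A i j"
      using parcs_Gamma2_un[of s 1 t u n v] st TU by blast
  qed
  also have "graph_Aut B \<cong> ?G"
  proof (rule Aut_iso)
    show "group ?G" by (intro DirProd_group sym_group_is_group)
    let ?\<pi> = "\<lambda>(x, y, z) i. i"
    let ?\<nu> = "\<lambda>(x, y, z) i. if i = 0 then x else if i = 1 then y else z :: nat \<Rightarrow> nat"
    show "\<exists>x\<in>carrier ?G. \<forall>i\<in>?I. ?\<pi> x i = h i \<and> ?\<nu> x i = \<sigma> i"
      if h: "h \<in> weighted_auts ?I m A" and \<sigma>: "\<And>i. i \<in> ?I \<Longrightarrow> \<sigma> i permutes {1..m i}"
      for h \<sigma>
    proof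
      show "(\<sigma> 0, \<sigma> 1, \<sigma> 2) \<in> carrier ?G"
        using \<sigma>[of 0] \<sigma>[of 1] \<sigma>[of 2] by (simp add: sym_group_def m_def)
      have inj: "inj_on h ?I" and hI: "\<And>i. i \<in> ?I \<Longrightarrow> h i \<in> ?I"
        and hA: "\<And>i j. i \<in> ?I \<Longrightarrow> j \<in> ?I \<Longrightarrow> A (h i) (h j) \<longleftrightarrow> A i j"
        by (fact weighted_autsD[OF h])+
      \<comment> \<open>The only loop is at 0, the only other neighbour of 0 is 1, and 2 is what
        remains.\<close>
      have "h 0 = 0" using hA[of 0 0] hI[of 0] by (auto simp: A_def)
      moreover have "h 1 = 1"
        using hA[of 0 1] hA[of 1 1] hI[of 1] \<open>h 0 = 0\<close> by (auto simp: A_def)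
      moreover have "h 2 = 2"
        using hI[of 2] inj calculation by (auto simp: inj_on_def)
      ultimately show "\<forall>i\<in>?I. ?\<pi> (\<sigma> 0, \<sigma> 1, \<sigma> 2) i = h i \<and> ?\<nu> (\<sigma> 0, \<sigma> 1, \<sigma> 2) i = \<sigma> i"
        by simp
    qed
    show "x = y" if "x \<in> carrier ?G" "y \<in> carrier ?G"
      "\<And>i. i \<in> ?I \<Longrightarrow> ?\<pi> x i = ?\<pi> y i \<and> ?\<nu> x i = ?\<nu> y i" for x y
      using that(3)[of 0] that(3)[of 1] that(3)[of 2] by (auto split: prod.splits)
    show "?\<pi> x \<in> weighted_auts ?I m A" for x
      by (cases x) (simp add: weighted_auts_id)
    show "?\<nu> x i permutes {1..m i}" if x_in: "x \<in> carrier ?G" and i: "i \<in> ?I" for x i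
    proof -
      obtain p q r where x: "x = (p, q, r)" by (cases x)
      have pqr: "p permutes {1..2*n}" "q permutes {1..2*n}" "r permutes {1..4*n}"
        using x_in by (simp_all add: x sym_group_carrier)
      have "i = 0 \<or> i = 1 \<or> i = 2" using i by blast
      then show ?thesis using pqr by (elim disjE) (simp_all add: x m_def)
    qed
    show "?\<pi> (x \<otimes>\<^bsub>?G\<^esub> y) i = ?\<pi> x (?\<pi> y i) \<and>
        ?\<nu> (x \<otimes>\<^bsub>?G\<^esub> y) (?\<pi> x i) = ?\<nu> x (?\<pi> x i) \<circ> ?\<nu> y i" for x y i
      by (cases x, cases y) (simp add: sym_group_mult)
  qed
  finally show ?thesis .
qed

text \<open>Every index other than 1 and 2 reads the third component, so \<open>get3_mult\<close>
  and \<open>get3_in_carrier\<close> hold without a bound on the index.\<close>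

definition get3 :: "'a \<times> 'a \<times> 'a \<Rightarrow> nat \<Rightarrow> 'a" where
  "get3 = (\<lambda>(x1, x2, x3) i. if i = 1 then x1 else if i = 2 then x2 else x3)"

text \<open>In this form the inverse cancels when the position read is itself an image under
  \<open>\<sigma>\<close>.\<close>

lemma get3_perm3_action:
  assumes "i \<in> {1..3}"
  shows "get3 (perm3_action \<sigma> x) i = get3 x (inv_into UNIV \<sigma> i)"
proof -
  have "i = 1 \<or> i = 2 \<or> i = 3" using assms by auto
  then show ?thesis
    by (cases x) (auto simp: get3_def perm3_action_def Let_def)
qed

lemma get3_eqI:
  assumes "\<And>i. i \<in> {1..3} \<Longrightarrow> get3 x i = get3 y i"
  shows "x = y"
  using assms[of 1] assms[of 2] assms[of 3] by (cases x, cases y) (auto simp: get3_def)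

lemma get3_mult:
  "get3 (x \<otimes>\<^bsub>G \<times>\<times> G \<times>\<times> G\<^esub> y) i = get3 x i \<otimes>\<^bsub>G\<^esub> get3 y i"
  by (cases x, cases y) (auto simp: get3_def)

lemma get3_in_carrier:
  "x \<in> carrier (G \<times>\<times> G \<times>\<times> G) \<Longrightarrow> get3 x i \<in> carrier G"
  by (auto simp: get3_def)

text \<open>Modulo 3, \<open>a + 2 * b\<close> vanishes iff \<open>a = b\<close>, so edges join only
  units with the same power of \<open>primitive_cube_root\<close> up to sign. Within one power the
  generic sign rule applies, which gives three disjoint copies of that graph.\<close>

lemma graph_Aut_Gamma2_un_3:
  assumes "n \<ge> 1"
  shows "graph_Aut (Gamma2_un 3 n) \<cong>
    semidirect
      ((sym_group (2*n) \<times>\<times> sym_group (2*n)) \<times>\<times>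
       (sym_group (2*n) \<times>\<times> sym_group (2*n)) \<times>\<times>
       (sym_group (2*n) \<times>\<times> sym_group (2*n)))
      perm3_action (sym_group 3)"
    (is "_ \<cong> ?G")
proof -
  let ?w = primitive_cube_root
  let ?D = "sym_group (2*n) \<times>\<times> sym_group (2*n)"
  \<comment> \<open>The exponents are taken from 1, 2, 3, the points on which
    \<open>sym_group 3\<close> acts.\<close>
  define t where "t = (\<lambda>(b, j :: nat). if b then - (?w ^ j) else ?w ^ j)"
  let ?I = "UNIV \<times> {1..3} :: (bool \<times> nat) set"
  let ?m = "\<lambda>_ :: bool \<times> nat. 2 * n"
  let ?A = "\<lambda>i j :: bool \<times> nat. (fst i \<or> fst j) \<and> snd i = snd j"
  have I3: "{1..3::nat} = {1, 2, 3}" by auto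
  have w: "?w ^ k = 1 \<longleftrightarrow> 3 dvd k" for k by (rule primitive_cube_root_power_eq_1_iff)
  have w3: "?w ^ 3 = 1" by (simp add: w)
  have w_neg: "?w ^ k \<noteq> -1" for k
  proof
    assume *: "?w ^ k = -1"
    have "(?w ^ k) ^ 3 = (?w ^ 3) ^ k" by (simp add: mult.commute flip: power_mult)
    then show False unfolding * w3 by simp
  qed
  have U: "U_set 3 = t ` ?I"
    unfolding I3 UNIV_bool by (auto simp: U_set_def t_def w3)
  interpret reduced_blowup ?I ?m ?A
  proof
    fix i j assume ij: "i \<in> ?I" "j \<in> ?I" and eq: "\<And>l. l \<in> ?I \<Longrightarrow> ?A i l \<longleftrightarrow> ?A j l"
    show "i = j"
      \<comment> \<open>The column \<open>(True, snd i)\<close> forces equal exponents; then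
        \<open>(False, snd i)\<close> compares the signs.\<close>
      using ij eq[of "(True, snd i)"] eq[of "(False, snd i)"] eq[of "(False, snd j)"]
      by (auto simp: prod_eq_iff)
  qed (use assms in auto)
  have t_mult: "t i * (t j)^2 = -1 \<longleftrightarrow> fst i \<and> snd i = snd j" if "i \<in> ?I" "j \<in> ?I" for i j
  proof -
    have "t i * (t j)^2 = (if fst i then - (?w ^ (snd i + 2 * snd j)) else ?w ^ (snd i + 2 * snd j))"
      by (cases i, cases j) (simp add: t_def power_add power_mult mult.commute)
    then have "t i * (t j)^2 = -1 \<longleftrightarrow> fst i \<and> 3 dvd (snd i + 2 * snd j)"
      using w_neg w by simp
    also have "3 dvd (snd i + 2 * snd j) \<longleftrightarrow> snd i = snd j"
    proof -
      have "1 \<le> snd i" "snd i \<le> 3" "1 \<le> snd j" "snd j \<le> 3" using that by auto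
      then show ?thesis by presburger
    qed
    finally show ?thesis .
  qed
  have t_inj: "inj_on t ?I"
  proof (rule inj_onI)
    fix i j assume ij: "i \<in> ?I" "j \<in> ?I" "t i = t j"
    \<comment> \<open>Pairing each unit with itself reveals its sign, and pairing it with the
      negative unit of exponent \<open>snd i\<close> reveals its exponent.\<close>
    then show "i = j"
      using t_mult[of i i] t_mult[of j j] t_mult[of i "(True, snd i)"]
        t_mult[of "(True, snd i)" i] t_mult[of "(True, snd i)" j]
      by (auto simp: prod_eq_iff)
  qed
  have "graph_Aut (Gamma2_un 3 n) \<cong> graph_Aut B"
  proof (rule graph_Aut_iso_blowup[where V = "\<lambda>i. S_tc1 (t i) n"])
    show "disjoint_family_on (\<lambda>i. S_tc1 (t i) n) ?I"
      unfolding disjoint_family_on_def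
    proof (intro ballI impI)
      fix i j assume "i \<in> ?I" "j \<in> ?I" "i \<noteq> j"
      then have "t i \<noteq> t j" using inj_on_eq_iff[OF t_inj] by blast
      then show "S_tc1 (t i) n \<inter> S_tc1 (t j) n = {}" by (rule S_tc1_disjoint)
    qed
    show "pverts (Gamma2_un 3 n) = (\<Union>i\<in>?I. S_tc1 (t i) n)"
      by (simp add: pverts_Gamma2_un U)
    fix i j u v
    assume ij: "i \<in> ?I" "j \<in> ?I" and uv: "u \<in> S_tc1 (t i) n" "v \<in> S_tc1 (t j) n"
    have "t i \<in> U_set 3" "t j \<in> U_set 3" unfolding U using ij by blast+
    then show "(u, v) \<in> parcs (Gamma2_un 3 n) \<longleftrightarrow> u \<noteq> v \<and> ?A i j"
      using parcs_Gamma2_un[OF _ _ uv] t_mult[OF ij] t_mult[OF ij(2,1)] by auto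
  qed (auto simp: finite_S_tc1 card_S_tc1)
  also have "graph_Aut B \<cong> ?G"
  proof (rule Aut_iso)
    show grp: "group ?G"
      by (intro semidirect_group perm3_action_hom DirProd_group sym_group_is_group)
    let ?\<pi> = "\<lambda>x i :: bool \<times> nat. (fst i, snd x (snd i) :: nat)"
    \<comment> \<open>In component \<open>j\<close>, the first permutation acts on the independent
      fibre and the second on the clique.\<close>
    define \<nu> where "\<nu> = (\<lambda>x :: (((nat \<Rightarrow> nat) \<times> (nat \<Rightarrow> nat)) \<times> ((nat \<Rightarrow> nat) \<times> (nat \<Rightarrow> nat)) \<times>
        ((nat \<Rightarrow> nat) \<times> (nat \<Rightarrow> nat))) \<times> (nat \<Rightarrow> nat). \<lambda>i :: bool \<times> nat.
        if fst i then snd (get3 (fst x) (snd i)) else fst (get3 (fst x) (snd i)))"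
    have G: "x \<in> carrier ?G \<longleftrightarrow> fst x \<in> carrier (?D \<times>\<times> ?D \<times>\<times> ?D) \<and> snd x permutes {1..3}" for x
      by (cases x) (simp add: semidirect_def sym_group_carrier)
    have D: "fst (get3 (fst x) j) permutes {1..2*n}" "snd (get3 (fst x) j) permutes {1..2*n}"
      if "x \<in> carrier ?G" for x j
    proof -
      have "get3 (fst x) j \<in> carrier ?D"
        by (rule get3_in_carrier) (use that G in blast)
      then show "fst (get3 (fst x) j) permutes {1..2*n}" "snd (get3 (fst x) j) permutes {1..2*n}"
        by (simp_all add: mem_Times_iff sym_group_carrier)
    qed
    show "?\<pi> x \<in> weighted_auts ?I ?m ?A" if "x \<in> carrier ?G" for x
    proof -
      have p: "snd x permutes {1..3}" using that G by blast
      have "bij_betw (?\<pi> x) ?I ?I"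
      proof (rule bij_betw_byWitness[where f' = "\<lambda>i. (fst i, inv_into UNIV (snd x) (snd i))"])
        show "?\<pi> x ` ?I \<subseteq> ?I"
          by (simp add: image_subset_iff mem_Times_iff permutes_in_image[OF p]
              del: atLeastAtMost_iff One_nat_def)
        show "(\<lambda>i. (fst i, inv_into UNIV (snd x) (snd i))) ` ?I \<subseteq> ?I"
          by (simp add: image_subset_iff mem_Times_iff permutes_in_image[OF permutes_inv[OF p]]
              del: atLeastAtMost_iff One_nat_def)
      qed (auto simp: permutes_inverses[OF p])
      then show ?thesis
        using permutes_inj[OF p] by (auto simp: weighted_auts_def inj_eq)
    qed
    show "\<nu> x i permutes {1..2*n}" if "x \<in> carrier ?G" for x i
      using D[OF that] by (simp add: \<nu>_def)
    show "?\<pi> (x \<otimes>\<^bsub>?G\<^esub> y) i = ?\<pi> x (?\<pi> y i) \<and> \<nu> (x \<otimes>\<^bsub>?G\<^esub> y) (?\<pi> x i) = \<nu> x (?\<pi> x i) \<circ> \<nu> y i"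
      if x: "x \<in> carrier ?G" and y: "y \<in> carrier ?G" and i: "i \<in> ?I" for x y i
    proof -
      have p: "snd x permutes {1..3}" using x G by blast
      have "snd i \<in> {1..3}" using i by (simp add: mem_Times_iff)
      then have si: "snd x (snd i) \<in> {1..3}" unfolding permutes_in_image[OF p] .
      have mult: "x \<otimes>\<^bsub>?G\<^esub> y = (fst x \<otimes>\<^bsub>?D \<times>\<times> ?D \<times>\<times> ?D\<^esub> perm3_action (snd x) (fst y), snd x \<circ> snd y)"
        by (cases x, cases y) (simp add: semidirect_def sym_group_mult)
      \<comment> \<open>At position \<open>snd x (snd i)\<close> the inverse inside the action
        cancels, leaving the entry of \<open>y\<close> at \<open>snd i\<close>.\<close>
      have "get3 (fst (x \<otimes>\<^bsub>?G\<^esub> y)) (snd x (snd i)) =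
          get3 (fst x) (snd x (snd i)) \<otimes>\<^bsub>?D\<^esub> get3 (fst y) (snd i)"
        unfolding mult fst_conv get3_mult get3_perm3_action[OF si] permutes_inverses(2)[OF p] ..
      moreover have "snd (x \<otimes>\<^bsub>?G\<^esub> y) = snd x \<circ> snd y" unfolding mult by simp
      ultimately show ?thesis
        by (simp add: \<nu>_def mult_DirProd' sym_group_mult del: mult_DirProd)
    qed
    show "x = y" if xy: "x \<in> carrier ?G" "y \<in> carrier ?G"
      and eq: "\<And>i. i \<in> ?I \<Longrightarrow> ?\<pi> x i = ?\<pi> y i \<and> \<nu> x i = \<nu> y i" for x y
    proof (rule prod_eqI)
      show "fst x = fst y"
      proof (rule get3_eqI)
        fix j :: nat assume "j \<in> {1..3}"
        then show "get3 (fst x) j = get3 (fst y) j"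
          using eq[of "(True, j)"] eq[of "(False, j)"] by (simp add: \<nu>_def prod_eq_iff)
      qed
      show "snd x = snd y"
      proof
        fix j
        show "snd x j = snd y j"
        proof (cases "j \<in> {1..3}")
          case True
          then show ?thesis using eq[of "(True, j)"] by simp
        next
          case False
          then show ?thesis
            using xy G[of x] G[of y] by (metis permutes_not_in)
        qed
      qed
    qed
    show "\<exists>x\<in>carrier ?G. \<forall>i\<in>?I. ?\<pi> x i = h i \<and> \<nu> x i = \<sigma> i"
      if h: "h \<in> weighted_auts ?I ?m ?A" and \<sigma>: "\<And>i. i \<in> ?I \<Longrightarrow> \<sigma> i permutes {1..2*n}"
      for h \<sigma>
    proof -
      have inj: "inj_on h ?I" and hI: "\<And>i. i \<in> ?I \<Longrightarrow> h i \<in> ?I"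
        and hA: "\<And>i j. i \<in> ?I \<Longrightarrow> j \<in> ?I \<Longrightarrow> ?A (h i) (h j) \<longleftrightarrow> ?A i j"
        by (fact weighted_autsD[OF h])+
      define \<tau> where "\<tau> = (\<lambda>j. if j \<in> {1..3} then snd (h (False, j)) else j)"
      have h_app: "h (b, j) = (b, \<tau> j)" if j: "j \<in> {1..3}" for b j
      proof -
        \<comment> \<open>Loops occur exactly at sign \<open>True\<close>, so \<open>h\<close> keeps
          signs; the edge between the two signs of one exponent then makes both move to the same
          copy.\<close>
        have "fst (h (b, j)) = b" using hA[of "(b, j)" "(b, j)"] j by auto
        moreover have "snd (h (True, j)) = snd (h (False, j))"
          using hA[of "(True, j)" "(False, j)"] j by auto
        ultimately show ?thesis using j by (cases b) (auto simp: \<tau>_def prod_eq_iff)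
      qed
      have \<tau>I: "\<tau> j \<in> {1..3}" if "j \<in> {1..3}" for j
        using hI[of "(True, j)"] h_app[OF that] that by auto
      have "inj_on \<tau> {1..3}"
      proof (rule inj_onI)
        fix j k assume jk: "j \<in> {1..3}" "k \<in> {1..3}" "\<tau> j = \<tau> k"
        then have "h (True, j) = h (True, k)" by (simp add: h_app)
        then show "j = k" using inj_onD[OF inj, of "(True, j)" "(True, k)"] jk by simp
      qed
      moreover from this have "\<tau> ` {1..3} = {1..3}"
        using \<tau>I by (intro endo_inj_surj) auto
      ultimately have "\<tau> permutes {1..3}"
        by (intro bij_imp_permutes) (auto simp: bij_betw_def \<tau>_def)
      define x where "x = (((\<sigma> (False, 1), \<sigma> (True, 1)), (\<sigma> (False, 2), \<sigma> (True, 2)),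
        (\<sigma> (False, 3), \<sigma> (True, 3))), \<tau>)"
      have "x \<in> carrier ?G"
        unfolding G using \<sigma> \<open>\<tau> permutes {1..3}\<close> by (simp add: x_def sym_group_carrier)
      moreover have "?\<pi> x i = h i \<and> \<nu> x i = \<sigma> i" if i: "i \<in> ?I" for i
      proof -
        obtain b j where bj: "i = (b, j)" by (cases i)
        then have j: "j \<in> {1..3}" using i by auto
        then have "j = 1 \<or> j = 2 \<or> j = 3" by auto
        then show ?thesis unfolding bj h_app[OF j] by (auto simp: x_def \<nu>_def get3_def)
      qed
      ultimately show ?thesis by blast
    qed
  qed
  finally show ?thesis .
qed

theorem theorem4p5:
  fixes d n :: nat
  assumes "d = 0 \<or> (d > 0 \<and> squarefree d)"
    and "n \<ge> 1"
  shows "(graph_Aut (Gamma1 d n) \<cong>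
           semidirect (sym_group (2*n) \<times>\<times> sym_group (2*n)) swap_action C2)
    \<and> (d \<noteq> 1 \<and> d \<noteq> 3 \<longrightarrow>
         graph_Aut (Gamma2_un d n) \<cong> sym_group (2*n) \<times>\<times> sym_group (2*n))
    \<and> (d = 1 \<longrightarrow>
         graph_Aut (Gamma2_un d n) \<cong>
           sym_group (2*n) \<times>\<times> sym_group (2*n) \<times>\<times> sym_group (4*n))
    \<and> (d = 3 \<longrightarrow>
         graph_Aut (Gamma2_un d n) \<cong>
           semidirect
             ((sym_group (2*n) \<times>\<times> sym_group (2*n)) \<times>\<times>
              (sym_group (2*n) \<times>\<times> sym_group (2*n)) \<times>\<times>
              (sym_group (2*n) \<times>\<times> sym_group (2*n)))
             perm3_action (sym_group 3))"
  using graph_Aut_Gamma1[OF assms(2)] graph_Aut_Gamma2_un_generic[OF assms(2)]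
    graph_Aut_Gamma2_un_1[OF assms(2)] graph_Aut_Gamma2_un_3[OF assms(2)]
  by blast

end
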